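(* Let $0\leqslant\alpha<1$, $\beta>0$ and let $n\geqslant 1$ be an integer. Let $\mathcal{F}_{\alpha,\beta,n}$ be the family of all functions $F(z)=f(z)(Q(z))^{\beta/n}$ on $\mathbb{D}$, where $f\in\mathcal{ST}(\alpha)$ and $Q$ is a polynomial of degree $n$ with $Q(0)=1$ and all zeros in $\mathbb{C}\setminus\mathbb{D}$. Then the $\mathcal{S}^{*}_{R}$-radius of this family, that is, the largest $\rho\in(0,1)$ such that $z\mapsto r^{-1}F(rz)$ belongs to $\mathcal{S}^{*}_{R}$ for all $F\in\mathcal{F}_{\alpha,\beta,n}$ and all $0<r<\rho$, is \[R_{\mathcal{S}^{*}_{R}}(F)=\begin{cases}\sigma_0 & \text{if } 2\alpha+\beta-2\geqslant 0,\\ \sigma_0 & \text{if } 2\alpha+\beta-2<0 \text{ and } X(\alpha,\beta)\leqslant 0,\\ \tilde{\sigma}_0 & \text{if } 2\alpha+\beta-2<0 \text{ and } X(\alpha,\beta)>0,\end{cases}\] where \[\sigma_0=\dfrac{2(3-2\sqrt{2})}{(2-2\alpha+\beta)+\sqrt{(-2+2\alpha-\beta)^2-4(3-2\sqrt{2})(2\sqrt{2}-1-2\alpha-\beta)}},\] \[\tilde{\sigma}_0=\dfrac{2}{(2-2\alpha+\beta)+\sqrt{(-2+2\alpha-\beta)^2-4(2\alpha-3+\beta)}},\] and \[\begin{aligned}X(\alpha,\beta)={}&2(2\alpha-2-\beta)(1+\sqrt{2}-2\alpha-\beta)\Bigl((2\alpha-2-\beta)+\sqrt{(2\alpha-2-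\beta)^2-4(3-2\sqrt{2})(2\sqrt{2}-1-2\alpha-\beta)}\Bigr)\\&+4(1-2\sqrt{2}+2\alpha+\beta)\Bigl((3-2\sqrt{2})(1+\sqrt{2}-2\alpha-\beta)+(1-\sqrt{2})(1-2\sqrt{2}+2\alpha+\beta)\Bigr).\end{aligned}\]
   Context: $\mathbb{D}=\{z\in\mathbb{C}:|z|<1\}$. $\mathcal{A}$ is the class of analytic functions $f$ on $\mathbb{D}$ with $f(0)=0$, $f'(0)=1$. For $0\leqslant\alpha<1$, $\mathcal{ST}(\alpha)$ (starlike functions of order $\alpha$) is the class of $f\in\mathcal{A}$ with $\operatorname{Re}(zf'(z)/f(z))>\alpha$ for all $z\in\mathbb{D}$ (the quotient being given the value $1$ at $z=0$). For analytic $g,h$ on $\mathbb{D}$, $g\prec h$ (subordination) means $g=h\circ w$ for some analytic $w:\mathbb{D}\to\mathbb{D}$ with $w(0)=0$. $\mathcal{S}^{*}_{R}$ (starlike functions associated with a rational function) is the class of $f\in\mathcal{A}$ with $zf'(z)/f(z)\prec\varphi_R(z)$, where $\varphi_R(z)=1+\dfrac{z^2+kz}{k^2-kz}$ and $k=\sqrt{2}+1$. Since $Q$ is non-vanishing in $\mathbb{D}$ and $Q(0)=1$, $(Q(z))^{\beta/n}$ denotes the analytic branch on $\mathbb{D}$ equal to $1$ at $z=0$, so $F\in\mathcal{A}$.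
   Formalization: The parameters with 2α+β = 2√2−1 and β < (3−2√2)(2^{1/4}−1)/2 are excluded: there X = 0, so the printed formula gives σ₀, but σ̃₀ < σ₀ and zF'/F = 2 at z = σ̃₀ for F = z(1−z)^{2α−2}(1+z)^β, so the printed radius is false. *)

theory Defs
  imports "HOL-Complex_Analysis.Complex_Analysis" "HOL-Computational_Algebra.Polynomial"
begin

text \<open>
  Functions on the unit disk are represented by total functions \<^typ>\<open>complex \<Rightarrow> complex\<close>;
  every notion below depends only on their values on the disk.
\<close>

abbreviation unit_disk :: "complex set" where
  "unit_disk \<equiv> ball 0 1"

definition class_A :: "(complex \<Rightarrow> complex) set" where
  "class_A = {f. f holomorphic_on unit_disk \<and> f 0 = 0 \<and> deriv f 0 = 1}"

definition starlike_quot :: "(complex \<Rightarrow> complex) \<Rightarrow> complex \<Rightarrow> complex" where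
  "starlike_quot f z = (if z = 0 then 1 else z * deriv f z / f z)"

text \<open>
  Both classes of starlike functions below say explicitly that \<^term>\<open>f\<close> has no zero in the
  punctured disk, so that the convention \<open>x / 0 = 0\<close> plays no role.
\<close>

definition ST :: "real \<Rightarrow> (complex \<Rightarrow> complex) set" where
  "ST \<alpha> = {f \<in> class_A. (\<forall>z\<in>unit_disk - {0}. f z \<noteq> 0) \<and>
                        (\<forall>z\<in>unit_disk. Re (starlike_quot f z) > \<alpha>)}"

definition subordinate :: "(complex \<Rightarrow> complex) \<Rightarrow> (complex \<Rightarrow> complex) \<Rightarrow> bool" where
  "subordinate g h \<longleftrightarrow> g holomorphic_on unit_disk \<and> h holomorphic_on unit_disk \<and>
     (\<exists>w. w holomorphic_on unit_disk \<and> w \<in> unit_disk \<rightarrow> unit_disk \<and> w 0 = 0 \<and>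
          (\<forall>z\<in>unit_disk. g z = h (w z)))"

definition \<phi>_R :: "complex \<Rightarrow> complex" where
  "\<phi>_R z = (let k = of_real (sqrt 2 + 1) in 1 + (z^2 + k * z) / (k^2 - k * z))"

definition S_R :: "(complex \<Rightarrow> complex) set" where
  "S_R = {f \<in> class_A. (\<forall>z\<in>unit_disk - {0}. f z \<noteq> 0) \<and> subordinate (starlike_quot f) \<phi>_R}"

text \<open>
  \<open>is_power_branch q c h\<close>: on the disk, \<^term>\<open>h\<close> is the analytic branch of \<open>q\<^sup>c\<close> with value 1
  at 0, that is \<open>exp (c * L)\<close> for the analytic logarithm \<^term>\<open>L\<close> of \<^term>\<open>q\<close> with \<open>L 0 = 0\<close>.
\<close>

definition is_power_branch ::
    "(complex \<Rightarrow> complex) \<Rightarrow> real \<Rightarrow> (complex \<Rightarrow> complex) \<Rightarrow> bool" where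
  "is_power_branch q c h \<longleftrightarrow>
     (\<exists>L. L holomorphic_on unit_disk \<and> L 0 = 0 \<and>
          (\<forall>z\<in>unit_disk. exp (L z) = q z \<and> h z = exp (of_real c * L z)))"

lemma power_branch_exists:
  assumes "q holomorphic_on unit_disk" "\<And>z. z \<in> unit_disk \<Longrightarrow> q z \<noteq> 0" "q 0 = 1"
  shows "\<exists>h. is_power_branch q c h"
proof -
  have "contractible unit_disk"
    by (simp add: convex_imp_contractible)
  with assms(1,2) obtain g where g: "g holomorphic_on unit_disk"
      "\<And>z. z \<in> unit_disk \<Longrightarrow> q z = exp (g z)"
    using contractible_imp_holomorphic_log[of q unit_disk] by blast
  have "exp (g 0) = 1" using g(2)[of 0] assms(3) by simp
  with g have "is_power_branch q c (\<lambda>z. exp (of_real c * (g z - g 0)))"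
    unfolding is_power_branch_def
    by (intro exI[of _ "\<lambda>z. g z - g 0"]) (auto intro!: holomorphic_intros simp: exp_diff)
  thus ?thesis by blast
qed

definition family_F :: "real \<Rightarrow> real \<Rightarrow> nat \<Rightarrow> (complex \<Rightarrow> complex) set" where
  "family_F \<alpha> \<beta> n = {F. \<exists>f Q h. f \<in> ST \<alpha> \<and>
      degree Q = n \<and> poly Q 0 = 1 \<and> (\<forall>z. poly Q z = 0 \<longrightarrow> z \<notin> unit_disk) \<and>
      is_power_branch (poly Q) (\<beta> / real n) h \<and>
      (\<forall>z\<in>unit_disk. F z = f z * h z)}"

definition admissible_radii ::
    "(complex \<Rightarrow> complex) set \<Rightarrow> (complex \<Rightarrow> complex) set \<Rightarrow> real set" where
  "admissible_radii \<S> \<F> = {\<rho>. 0 < \<rho> \<and> \<rho> < 1 \<and>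
     (\<forall>F\<in>\<F>. \<forall>r. 0 < r \<and> r < \<rho> \<longrightarrow> (\<lambda>z. F (of_real r * z) / of_real r) \<in> \<S>)}"

definition is_class_radius ::
    "(complex \<Rightarrow> complex) set \<Rightarrow> (complex \<Rightarrow> complex) set \<Rightarrow> real \<Rightarrow> bool" where
  "is_class_radius \<S> \<F> \<rho> \<longleftrightarrow>
     \<rho> \<in> admissible_radii \<S> \<F> \<and> (\<forall>\<rho>'\<in>admissible_radii \<S> \<F>. \<rho>' \<le> \<rho>)"

definition \<sigma>0 :: "real \<Rightarrow> real \<Rightarrow> real" where
  "\<sigma>0 \<alpha> \<beta> = 2 * (3 - 2 * sqrt 2) /
     ((2 - 2 * \<alpha> + \<beta>) +
      sqrt ((- 2 + 2 * \<alpha> - \<beta>)^2 - 4 * (3 - 2 * sqrt 2) * (2 * sqrt 2 - 1 - 2 * \<alpha> - \<beta>)))"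

definition \<sigma>0_tilde :: "real \<Rightarrow> real \<Rightarrow> real" where
  "\<sigma>0_tilde \<alpha> \<beta> = 2 /
     ((2 - 2 * \<alpha> + \<beta>) + sqrt ((- 2 + 2 * \<alpha> - \<beta>)^2 - 4 * (2 * \<alpha> - 3 + \<beta>)))"

definition X :: "real \<Rightarrow> real \<Rightarrow> real" where
  "X \<alpha> \<beta> =
     2 * (2 * \<alpha> - 2 - \<beta>) * (1 + sqrt 2 - 2 * \<alpha> - \<beta>) *
       ((2 * \<alpha> - 2 - \<beta>) +
        sqrt ((2 * \<alpha> - 2 - \<beta>)^2 - 4 * (3 - 2 * sqrt 2) * (2 * sqrt 2 - 1 - 2 * \<alpha> - \<beta>))) +
     4 * (1 - 2 * sqrt 2 + 2 * \<alpha> + \<beta>) *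
       ((3 - 2 * sqrt 2) * (1 + sqrt 2 - 2 * \<alpha> - \<beta>) +
        (1 - sqrt 2) * (1 - 2 * sqrt 2 + 2 * \<alpha> + \<beta>))"

text \<open>
  On the line \<open>2 * \<alpha> + \<beta> = 2 * sqrt 2 - 1\<close> the quadratic equation for \<open>\<sigma>0\<close> becomes linear and
  \<open>X\<close> vanishes identically. Off the line, \<open>X\<close> has the sign of \<open>a - sqrt 2\<close>, where
  \<open>a = (1 + (1 - 2 * \<alpha> - \<beta>) * r\<^sup>2) / (1 - r\<^sup>2)\<close> at \<open>r = \<sigma>0\<close> is the center of the disk
  containing the values of \<open>z * F' / F\<close> for \<open>norm z = r\<close>, because
  \<open>X = 4 * (2 * sqrt 2 - 1 - 2 * \<alpha> - \<beta>)\<^sup>2 * ((1 + sqrt 2 - 2 * \<alpha> - \<beta>) * \<sigma>0\<^sup>2 - (sqrt 2 - 1))\<close>.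
  On the part of the line with \<open>\<beta> < (3 - 2 * sqrt 2) * (root 4 2 - 1) / 2\<close> one has
  \<open>\<sigma>0_tilde < \<sigma>0\<close> and the radius is \<open>\<sigma>0_tilde\<close>, although \<open>X \<le> 0\<close>: the function
  \<open>z * (1 - z) powr (2 * \<alpha> - 2) * (1 + z) powr \<beta>\<close> of the family has \<open>z * F' / F = 2 = \<phi>_R 1\<close> at
  \<open>z = \<sigma>0_tilde\<close>. These exceptional parameters have to be excluded.
\<close>

definition exceptional :: "real \<Rightarrow> real \<Rightarrow> bool" where
  "exceptional \<alpha> \<beta> \<longleftrightarrow>
     2 * \<alpha> + \<beta> = 2 * sqrt 2 - 1 \<and> \<beta> < (3 - 2 * sqrt 2) * (root 4 2 - 1) / 2"

end

theory Submission
  imports Defs "HOL-Computational_Algebra.Fundamental_Theorem_Algebra"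
begin

text \<open>
  Put \<open>u = 1 - (sqrt 2 - 1) * z\<close>. Then \<open>\<phi>_R z = u + 2 / u - 2\<close>, so \<open>\<phi>_R\<close> is a Joukowski map; it is
  injective on the unit disk, because there \<open>norm u < sqrt 2\<close>, and its image contains every disk
  with center on the real axis that stays strictly between the boundary points
  \<open>\<phi>_R (- 1) = 2 * sqrt 2 - 2\<close> and \<open>\<phi>_R 1 = 2\<close> on that axis.
  For \<open>norm z = r\<close> the values of \<open>z * F' / F\<close> lie in a disk with real center: the factor in \<open>ST \<alpha>\<close>
  and each linear factor of \<open>Q\<close> contribute a multiple of \<open>1 / (1 - w)\<close> with \<open>norm w \<le> r\<close>.
  This disk touches the left boundary point at \<open>r = \<sigma>0\<close> and the right one at
  \<open>r = \<sigma>0_tilde\<close>, so the radius is the minimum of the two. The function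
  \<open>z * (1 - z) powr (2 * \<alpha> - 2) * (1 + z) powr \<beta>\<close> attains both values, at \<open>- \<sigma>0\<close> and at
  \<open>\<sigma>0_tilde\<close>, and \<open>\<phi>_R\<close> omits both on the open disk.
\<close>

section \<open>The smaller root of a quadratic\<close>

text \<open>By \<open>0 < C\<close> and \<open>A + C < b\<close> the quadratic is positive at 0 and
  negative at 1, so it changes sign exactly once in between. With the square root in the
  denominator, one formula covers positive, zero and negative \<open>A\<close>.\<close>

lemma smaller_quadratic_root:
  fixes A b C :: real
  assumes "0 < C" "0 < b" "A + C < b"
  defines "r \<equiv> 2 * C / (b + sqrt (b\<^sup>2 - 4 * A * C))"
  shows "0 < r" "r < 1" "A * r\<^sup>2 - b * r + C = 0"
    and "2 * A * r = b - sqrt (b\<^sup>2 - 4 * A * C)"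
    and "\<And>x. 0 \<le> x \<Longrightarrow> x \<le> 1 \<Longrightarrow> sgn (A * x\<^sup>2 - b * x + C) = sgn (r - x)"
proof -
  define D where "D = sqrt (b\<^sup>2 - 4 * A * C)"
  \<comment> \<open>For positive \<open>A\<close> this is AM-GM:
    \<open>4 * A * C \<le> (A + C)^2\<close>, and \<open>0 < A + C < b\<close>.\<close>
  have "4 * A * C \<le> b\<^sup>2"
  proof (cases "A \<le> 0")
    case True
    then have "A * C \<le> 0"
      using assms(1) by (simp add: mult_nonpos_nonneg)
    moreover have "0 \<le> b\<^sup>2" by simp
    ultimately show ?thesis by linarith
  next
    case False
    then have "(A + C)\<^sup>2 \<le> b\<^sup>2"
      using assms by (intro power_mono) auto
    moreover have "0 \<le> (A - C)\<^sup>2" by simp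
    ultimately show ?thesis
      by (simp add: power2_eq_square algebra_simps)
  qed
  then have D: "0 \<le> D" "D\<^sup>2 = b\<^sup>2 - 4 * A * C"
    by (auto simp: D_def)
  have r: "(b + D) * r = 2 * C"
    using assms(2) D(1) by (simp add: r_def D_def[symmetric])
  show "0 < r"
    using assms(1,2) D(1) by (simp add: r_def D_def[symmetric] add_pos_nonneg)
  have "2 * C < b + D"
  proof (rule ccontr)
    assume "\<not> ?thesis"
    then have "D \<le> 2 * C - b" by simp
    then have "D\<^sup>2 \<le> (2 * C - b)\<^sup>2"
      using D(1) by (intro power_mono)
    then have "C * b \<le> C * (A + C)"
      using D(2) by (simp add: power2_eq_square algebra_simps)
    then show False
      using assms(1,3) by simp
  qed
  then show "r < 1"
    using assms(2) D(1) by (simp add: r_def D_def[symmetric])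
  have "(b + D)\<^sup>2 * (A * r\<^sup>2 - b * r + C) =
      A * ((b + D) * r)\<^sup>2 - b * (b + D) * ((b + D) * r) + C * (b + D)\<^sup>2"
    by (simp add: power2_eq_square algebra_simps)
  also have "\<dots> = C * (D\<^sup>2 - b\<^sup>2 + 4 * A * C)"
    unfolding r by (simp add: power2_eq_square algebra_simps)
  also have "\<dots> = 0"
    using D(2) by simp
  finally show root: "A * r\<^sup>2 - b * r + C = 0"
    using assms(2) D(1) by simp
  have "(b + D) * (2 * A * r) = (b + D) * (b - D)"
    using D(2) arg_cong[OF r, of "\<lambda>t. 2 * A * t"] by (simp add: power2_eq_square algebra_simps)
  then have "2 * A * r = b - D"
    using assms(2) D(1) by simp
  then show "2 * A * r = b - sqrt (b\<^sup>2 - 4 * A * C)"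
    by (simp add: D_def)
  fix x :: real
  assume x: "0 \<le> x" "x \<le> 1"
  \<comment> \<open>Multiplying by \<open>r\<close> gives the factorization over both roots without
    division by \<open>A\<close>. For nonzero \<open>A\<close> the other root is
    \<open>C / (A * r)\<close>, and \<open>pos\<close> places it outside the unit interval.\<close>
  have eq: "r * (A * x\<^sup>2 - b * x + C) = (r - x) * (C - A * r * x)" for x
    using arg_cong[OF root, of "\<lambda>t. x * t"] by (simp add: power2_eq_square algebra_simps)
  have pos: "0 < C - A * r * x"
  proof (cases "A \<le> 0")
    case True
    then have "A * r * x \<le> 0"
      using \<open>0 < r\<close> x(1) by (simp add: mult_nonpos_nonneg)
    then show ?thesis
      using assms(1) by linarith
  next
    case False
    have "r * (A - b + C) = (r - 1) * (C - A * r)"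
      using eq[of 1] by simp
    then have "(1 - r) * (C - A * r) = r * (b - A - C)"
      by (simp add: algebra_simps)
    moreover have "0 < r * (b - A - C)"
      using \<open>0 < r\<close> assms(3) by simp
    ultimately have "0 < C - A * r"
      using \<open>r < 1\<close> by (smt (verit) mult_nonneg_nonpos)
    moreover have "A * r * x \<le> A * r"
      using False \<open>0 < r\<close> x by (simp add: mult_left_le)
    ultimately show ?thesis by linarith
  qed
  have "sgn (A * x\<^sup>2 - b * x + C) = sgn (r * (A * x\<^sup>2 - b * x + C))"
    using \<open>0 < r\<close> by (simp add: sgn_mult)
  also have "\<dots> = sgn (r - x)"
    unfolding eq using pos by (simp add: sgn_mult)
  finally show "sgn (A * x\<^sup>2 - b * x + C) = sgn (r - x)" .
qed

lemma sqrt_2_less: "2 * sqrt 2 < (3::real)"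
  using real_less_lsqrt[of "3 / 2" 2] by (simp add: power2_eq_square)

section \<open>The two candidate radii and their comparison\<close>

text \<open>Divided by \<open>1 - x^2\<close>, the quadratic is the gap between the left end of the
  disk of values for \<open>norm z = x\<close> and the boundary point \<open>2 * sqrt 2 - 2\<close>.
  Its value at 1 is \<open>- 2 * \<beta>\<close>.\<close>

lemma \<sigma>0_root:
  fixes \<alpha> \<beta> :: real
  assumes "\<alpha> < 1" "0 < \<beta>"
  shows "0 < \<sigma>0 \<alpha> \<beta>" "\<sigma>0 \<alpha> \<beta> < 1"
    and "(2 * sqrt 2 - 1 - 2 * \<alpha> - \<beta>) * (\<sigma>0 \<alpha> \<beta>)\<^sup>2 - (2 - 2 * \<alpha> + \<beta>) * \<sigma>0 \<alpha> \<beta>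
           + (3 - 2 * sqrt 2) = 0"
    and "2 * (2 * sqrt 2 - 1 - 2 * \<alpha> - \<beta>) * \<sigma>0 \<alpha> \<beta> = (2 - 2 * \<alpha> + \<beta>)
           - sqrt ((2 - 2 * \<alpha> + \<beta>)\<^sup>2 - 4 * (2 * sqrt 2 - 1 - 2 * \<alpha> - \<beta>) * (3 - 2 * sqrt 2))"
    and "\<And>x. 0 \<le> x \<Longrightarrow> x \<le> 1 \<Longrightarrow>
           sgn ((2 * sqrt 2 - 1 - 2 * \<alpha> - \<beta>) * x\<^sup>2 - (2 - 2 * \<alpha> + \<beta>) * x + (3 - 2 * sqrt 2))
             = sgn (\<sigma>0 \<alpha> \<beta> - x)"
proof -
  have C: "0 < 3 - 2 * sqrt (2::real)"
    using sqrt_2_less by simp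
  have b: "0 < 2 - 2 * \<alpha> + \<beta>"
    and A: "(2 * sqrt 2 - 1 - 2 * \<alpha> - \<beta>) + (3 - 2 * sqrt 2) < 2 - 2 * \<alpha> + \<beta>"
    using assms by auto
  have "\<sigma>0 \<alpha> \<beta> = 2 * (3 - 2 * sqrt 2) / ((2 - 2 * \<alpha> + \<beta>) + sqrt ((2 - 2 * \<alpha> + \<beta>)\<^sup>2
      - 4 * (2 * sqrt 2 - 1 - 2 * \<alpha> - \<beta>) * (3 - 2 * sqrt 2)))"
    unfolding \<sigma>0_def by (simp add: power2_eq_square algebra_simps)
  note * = smaller_quadratic_root[OF C b A, folded this]
  show "0 < \<sigma>0 \<alpha> \<beta>" "\<sigma>0 \<alpha> \<beta> < 1"
    "(2 * sqrt 2 - 1 - 2 * \<alpha> - \<beta>) * (\<sigma>0 \<alpha> \<beta>)\<^sup>2 - (2 - 2 * \<alpha> + \<beta>) * \<sigma>0 \<alpha> \<beta>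
           + (3 - 2 * sqrt 2) = 0"
    "2 * (2 * sqrt 2 - 1 - 2 * \<alpha> - \<beta>) * \<sigma>0 \<alpha> \<beta> = (2 - 2 * \<alpha> + \<beta>)
           - sqrt ((2 - 2 * \<alpha> + \<beta>)\<^sup>2 - 4 * (2 * sqrt 2 - 1 - 2 * \<alpha> - \<beta>) * (3 - 2 * sqrt 2))"
    by (fact *)+
  show "sgn ((2 * sqrt 2 - 1 - 2 * \<alpha> - \<beta>) * x\<^sup>2 - (2 - 2 * \<alpha> + \<beta>) * x + (3 - 2 * sqrt 2))
      = sgn (\<sigma>0 \<alpha> \<beta> - x)" if "0 \<le> x" "x \<le> 1" for x
    using that by (fact *)
qed

text \<open>The corresponding gap between the right end of the disk and the boundary point 2; the
  quadratic has the value \<open>- 4 * (1 - \<alpha>)\<close> at 1.\<close>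

lemma \<sigma>0_tilde_root:
  fixes \<alpha> \<beta> :: real
  assumes "\<alpha> < 1" "0 < \<beta>"
  shows "0 < \<sigma>0_tilde \<alpha> \<beta>" "\<sigma>0_tilde \<alpha> \<beta> < 1"
    and "(2 * \<alpha> - 3 + \<beta>) * (\<sigma>0_tilde \<alpha> \<beta>)\<^sup>2 - (2 - 2 * \<alpha> + \<beta>) * \<sigma>0_tilde \<alpha> \<beta> + 1 = 0"
    and "\<And>x. 0 \<le> x \<Longrightarrow> x \<le> 1 \<Longrightarrow>
           sgn ((2 * \<alpha> - 3 + \<beta>) * x\<^sup>2 - (2 - 2 * \<alpha> + \<beta>) * x + 1) = sgn (\<sigma>0_tilde \<alpha> \<beta> - x)"
proof -
  have b: "0 < 2 - 2 * \<alpha> + \<beta>" and A: "(2 * \<alpha> - 3 + \<beta>) + 1 < 2 - 2 * \<alpha> + \<beta>"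
    using assms by auto
  have "\<sigma>0_tilde \<alpha> \<beta> = 2 * 1 / ((2 - 2 * \<alpha> + \<beta>) + sqrt ((2 - 2 * \<alpha> + \<beta>)\<^sup>2
      - 4 * (2 * \<alpha> - 3 + \<beta>) * 1))"
    unfolding \<sigma>0_tilde_def by (simp add: power2_eq_square algebra_simps)
  note * = smaller_quadratic_root[OF zero_less_one b A, folded this]
  show "0 < \<sigma>0_tilde \<alpha> \<beta>" "\<sigma>0_tilde \<alpha> \<beta> < 1"
    "(2 * \<alpha> - 3 + \<beta>) * (\<sigma>0_tilde \<alpha> \<beta>)\<^sup>2 - (2 - 2 * \<alpha> + \<beta>) * \<sigma>0_tilde \<alpha> \<beta> + 1 = 0"
    by (fact *)+
  show "sgn ((2 * \<alpha> - 3 + \<beta>) * x\<^sup>2 - (2 - 2 * \<alpha> + \<beta>) * x + 1) = sgn (\<sigma>0_tilde \<alpha> \<beta> - x)"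
    if "0 \<le> x" "x \<le> 1" for x
    using that by (fact *)
qed

text \<open>Two factors \<open>A\<close> suffice to eliminate \<open>\<sigma>0\<close>: the first
  lets the quadratic lower its square to a linear term, the second lets the explicit root formula
  replace \<open>2 * A * \<sigma>0\<close> by \<open>b - D\<close>.\<close>

lemma X_eq:
  fixes \<alpha> \<beta> :: real
  assumes "\<alpha> < 1" "0 < \<beta>"
  shows "X \<alpha> \<beta> = 4 * (2 * sqrt 2 - 1 - 2 * \<alpha> - \<beta>)\<^sup>2 *
           ((1 + sqrt 2 - 2 * \<alpha> - \<beta>) * (\<sigma>0 \<alpha> \<beta>)\<^sup>2 - (sqrt 2 - 1))"
proof -
  define A b C where "A = 2 * sqrt 2 - 1 - 2 * \<alpha> - \<beta>" "b = 2 - 2 * \<alpha> + \<beta>"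
    "C = 3 - 2 * sqrt (2::real)"
  note defs = this
  define D E where "D = sqrt (b\<^sup>2 - 4 * A * C)" and "E = 1 + sqrt 2 - 2 * \<alpha> - \<beta>"
  note s = \<sigma>0_root(3,4)[OF assms, folded defs, folded D_def]
  have "4 * A\<^sup>2 * (E * (\<sigma>0 \<alpha> \<beta>)\<^sup>2 - (sqrt 2 - 1)) =
      4 * A * E * (A * (\<sigma>0 \<alpha> \<beta>)\<^sup>2) - 4 * A\<^sup>2 * (sqrt 2 - 1)"
    by (simp add: power2_eq_square algebra_simps)
  also have "A * (\<sigma>0 \<alpha> \<beta>)\<^sup>2 = b * \<sigma>0 \<alpha> \<beta> - C"
    using s(1) by simp
  also have "4 * A * E * (b * \<sigma>0 \<alpha> \<beta> - C) = 2 * b * E * (2 * A * \<sigma>0 \<alpha> \<beta>) - 4 * A * E * C"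
    by (simp add: algebra_simps)
  also have "\<dots> - 4 * A\<^sup>2 * (sqrt 2 - 1) =
      2 * (- b) * E * (- b + D) + 4 * (- A) * (C * E + (1 - sqrt 2) * (- A))"
    unfolding s(2) by (simp add: power2_eq_square algebra_simps)
  also have "\<dots> = X \<alpha> \<beta>"
  proof -
    have "D = sqrt ((2 * \<alpha> - 2 - \<beta>)\<^sup>2 - 4 * (3 - 2 * sqrt 2) * (2 * sqrt 2 - 1 - 2 * \<alpha> - \<beta>))"
      by (simp add: D_def defs power2_eq_square algebra_simps)
    moreover have "- A = 1 - 2 * sqrt 2 + 2 * \<alpha> + \<beta>" "- b = 2 * \<alpha> - 2 - \<beta>"
      by (simp_all add: defs)
    ultimately show ?thesis
      by (simp only: X_def defs(3) E_def)
  qed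
  finally show ?thesis
    by (simp add: E_def defs(1))
qed

text \<open>At \<open>r = \<sigma>0\<close> the disk of values touches \<open>2 * sqrt 2 - 2\<close>
  on the left, so its right end is at most 2 exactly if its centre is at most the midpoint
  \<open>sqrt 2\<close>. This is the condition \<open>Y \<le> 0\<close>, and by \<open>X_eq\<close>
  the signs of \<open>Y\<close> and \<open>X\<close> agree unless the squared factor
  vanishes.\<close>

lemma radius_eq_min:
  fixes \<alpha> \<beta> :: real
  assumes "\<alpha> < 1" "0 < \<beta>" "\<not> exceptional \<alpha> \<beta>"
  shows "(if 2 * \<alpha> + \<beta> - 2 \<ge> 0 then \<sigma>0 \<alpha> \<beta>
          else if X \<alpha> \<beta> \<le> 0 then \<sigma>0 \<alpha> \<beta>
          else \<sigma>0_tilde \<alpha> \<beta>) = min (\<sigma>0 \<alpha> \<beta>) (\<sigma>0_tilde \<alpha> \<beta>)"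
proof -
  define s where "s = \<sigma>0 \<alpha> \<beta>"
  define Y where "Y = (1 + sqrt 2 - 2 * \<alpha> - \<beta>) * s\<^sup>2 - (sqrt 2 - 1)"
  note s = \<sigma>0_root(1-3)[OF assms(1,2), folded s_def]
  have s2: "0 \<le> s\<^sup>2" "s\<^sup>2 \<le> 1"
    using s by (auto simp: power_le_one)
  have q: "1 < sqrt (2::real)" by simp
  \<comment> \<open>The linear term cancels against that of the quadratic for
    \<open>\<sigma>0\<close>, which vanishes at \<open>s\<close>.\<close>
  have T: "(2 * \<alpha> - 3 + \<beta>) * s\<^sup>2 - (2 - 2 * \<alpha> + \<beta>) * s + 1 = - 2 * Y"
    using s(3) by (simp add: Y_def algebra_simps)
  have "sgn (- 2 * Y) = sgn (\<sigma>0_tilde \<alpha> \<beta> - s)"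
    using \<sigma>0_tilde_root(4)[OF assms(1,2), of s] s T by simp
  then have le: "s \<le> \<sigma>0_tilde \<alpha> \<beta> \<longleftrightarrow> Y \<le> 0"
    by (auto simp: sgn_if split: if_splits)
  have X: "X \<alpha> \<beta> = 4 * (2 * sqrt 2 - 1 - 2 * \<alpha> - \<beta>)\<^sup>2 * Y"
    using X_eq[OF assms(1,2)] by (simp add: Y_def s_def)
  have "Y \<le> 0" if "2 * \<alpha> + \<beta> - 2 \<ge> 0"
  proof -
    have "(1 + sqrt 2 - 2 * \<alpha> - \<beta>) * s\<^sup>2 \<le> (sqrt 2 - 1) * s\<^sup>2"
      using that s2 by (intro mult_right_mono) auto
    also have "\<dots> \<le> sqrt 2 - 1"
      using s2 q by (simp add: mult_left_le)
    finally show ?thesis by (simp add: Y_def)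
  qed
  moreover have "Y \<le> 0" if "X \<alpha> \<beta> \<le> 0"
  proof (cases "2 * \<alpha> + \<beta> = 2 * sqrt 2 - 1")
    \<comment> \<open>Here \<open>X\<close> is 0 and carries no information. The quadratic is linear
      with root \<open>s = c / (c + 2 * \<beta>)\<close>, and
      \<open>Y = (sqrt 2 - 1) * (sqrt 2 * s^2 - 1)\<close>, so the claim becomes
      \<open>t * s \<le> 1\<close> with \<open>t\<close> the fourth root of 2. The lower bound on
      \<open>\<beta>\<close> from \<open>\<not> exceptional \<alpha> \<beta>\<close> yields exactly
      this.\<close>
    case True
    define c where "c = 3 - 2 * sqrt (2::real)"
    define t where "t = root 4 2"
    have t: "0 < t" "t\<^sup>2 = sqrt 2"
      unfolding t_def using real_root_mult_exp[of 2 2 "2::real"]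
      by (auto simp: sqrt_def)
    have c: "0 < c"
      using sqrt_2_less by (simp add: c_def)
    have b: "2 - 2 * \<alpha> + \<beta> = c + 2 * \<beta>" and A: "2 * sqrt 2 - 1 - 2 * \<alpha> - \<beta> = 0"
      using True by (auto simp: c_def)
    have "c * (t - 1) \<le> 2 * \<beta>"
      using assms(3) True by (simp add: exceptional_def c_def t_def)
    then have "c * t \<le> c + 2 * \<beta>"
      by (simp add: algebra_simps)
    moreover have "(c + 2 * \<beta>) * s = c"
      using s(3) unfolding b A by (simp add: c_def)
    ultimately have "c * t * s \<le> c"
      using s(1) by (metis mult_right_mono less_imp_le)
    then have "t * s \<le> 1"
      using c by (simp add: mult.assoc)
    then have "(t * s)\<^sup>2 \<le> 1"
      using t s(1) by (simp add: power_le_one)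
    then have "(sqrt 2 - 1) * (sqrt 2 * s\<^sup>2) \<le> (sqrt 2 - 1) * 1"
      using t q by (intro mult_left_mono) (auto simp: power_mult_distrib)
    moreover have "1 + sqrt 2 - 2 * \<alpha> - \<beta> = (sqrt 2 - 1) * sqrt 2"
      using True by (simp add: algebra_simps)
    ultimately show ?thesis
      by (simp add: Y_def mult.assoc)
  next
    case False
    then have "0 < 4 * (2 * sqrt 2 - 1 - 2 * \<alpha> - \<beta>)\<^sup>2"
      by auto
    then show ?thesis
      using that unfolding X by (simp add: mult_le_0_iff)
  qed
  moreover have "\<not> Y \<le> 0" if "\<not> X \<alpha> \<beta> \<le> 0"
    using that unfolding X by (auto simp: mult_le_0_iff)
  ultimately show ?thesis
    using le by (auto simp: s_def)
qed

section \<open>The map \<open>\<phi>_R\<close> and its image of the disk\<close>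

lemma \<phi>_R_eq:
  assumes "z \<noteq> of_real (sqrt 2 + 1)"
  shows "\<phi>_R z = (1 - of_real (sqrt 2 - 1) * z) + 2 / (1 - of_real (sqrt 2 - 1) * z) - 2"
proof -
  define k e :: complex where "k = of_real (sqrt 2 + 1)" and "e = of_real (sqrt 2 - 1)"
  have ke: "k * e = 1"
    unfolding k_def e_def of_real_mult[symmetric] by (simp add: algebra_simps)
  have "k \<noteq> 0" using ke by auto
  have "k - z \<noteq> 0"
    using assms by (simp add: k_def)
  have u: "1 - e * z = (k - z) / k"
    using ke \<open>k \<noteq> 0\<close> by (simp add: field_simps)
  have "\<phi>_R z = 1 + (z\<^sup>2 + k * z) / (k\<^sup>2 - k * z)"
    unfolding \<phi>_R_def Let_def k_def ..
  also have "k\<^sup>2 - k * z = k * (k - z)"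
    by (simp add: power2_eq_square algebra_simps)
  also have "1 + (z\<^sup>2 + k * z) / (k * (k - z)) = (z\<^sup>2 + k * k) / (k * (k - z))"
    using \<open>k \<noteq> 0\<close> \<open>k - z \<noteq> 0\<close> by (simp add: field_simps power2_eq_square)
  \<comment> \<open>Expanding the numerator in powers of \<open>k - z\<close> produces the terms
    \<open>u\<close>, \<open>2 / u\<close> and \<open>- 2\<close>, where
    \<open>u = (k - z) / k\<close>.\<close>
  also have "z\<^sup>2 + k * k = (k - z) * (k - z) + 2 * (k * k) - 2 * (k * (k - z))"
    by (simp add: field_simps power2_eq_square)
  also have "\<dots> / (k * (k - z)) = (k - z) / k + 2 / ((k - z) / k) - 2"
    using \<open>k \<noteq> 0\<close> \<open>k - z \<noteq> 0\<close> by (simp add: field_simps)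
  finally show ?thesis
    unfolding u e_def[symmetric] .
qed

text \<open>Writing \<open>x\<close> for the real part of \<open>u\<close>, the circle is \<open>norm u ^ 2 = 2 * x + 2 - 2 * sqrt 2\<close>,
  so \<open>norm (u + 2 / u - A) ^ 2\<close> is a function of the form \<open>p * m + q / m + r\<close> of \<open>m = norm u ^ 2\<close>
  whose minimum over the range of \<open>m\<close> is attained at an end point.\<close>

lemma joukowski_circle_dist:
  fixes u :: complex and a :: real
  assumes "norm (u - 1) = sqrt 2 - 1" "2 * sqrt 2 - 2 < a"
  shows "min (a - (2 * sqrt 2 - 2)) (2 - a) \<le> norm (u + 2 / u - 2 - of_real a)"
proof -
  define x y m e A where "x = Re u" and "y = Im u" and "m = (norm u)\<^sup>2"
    and "e = sqrt 2 - 1" and "A = a + 2"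
  have e: "0 < e" "e\<^sup>2 = 1 - 2 * e"
    by (auto simp: e_def power2_eq_square algebra_simps)
  have e12: "2 / 5 < e" "e < 1 / 2"
    using sqrt_2_less real_less_rsqrt[of "7 / 5" 2] by (auto simp: e_def power2_eq_square)
  have m: "m = x\<^sup>2 + y\<^sup>2"
    by (simp add: m_def x_def y_def cmod_power2)
  have "(x - 1)\<^sup>2 + y\<^sup>2 = e\<^sup>2"
    using arg_cong[OF assms(1), of "\<lambda>t. t\<^sup>2"] by (simp add: cmod_power2 x_def y_def e_def)
  then have circle: "m = 2 * x - 2 * e"
    using m e(2) by (simp add: power2_eq_square algebra_simps)
  have "(x - 1)\<^sup>2 \<le> e\<^sup>2"
    using \<open>(x - 1)\<^sup>2 + y\<^sup>2 = e\<^sup>2\<close> zero_le_power2[of y] by linarith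
  then have "\<bar>x - 1\<bar> \<le> e"
    using e(1) by (simp add: abs_le_square_iff[symmetric])
  \<comment> \<open>The ends of this range belong to \<open>u = 1 - e\<close> and
    \<open>u = 1 + e\<close>, that is to \<open>z = 1\<close> and \<open>z = - 1\<close>.\<close>
  then have mb: "2 - 4 * e \<le> m" "m \<le> 2"
    unfolding circle by auto
  have m0: "0 < m"
    using mb e12 by auto
  define G where "G = (\<lambda>m. (3 - A) * m + (4 + 8 * e\<^sup>2 - 4 * e * A) / m + 8 * e - 4 - A * (2 * e + 2) + A\<^sup>2)"
  have "u + 2 / u - of_real A = Complex (x + 2 * x / m - A) (y - 2 * y / m)"
    by (simp add: complex_eq_iff x_def y_def m_def Re_divide Im_divide cmod_power2)
  then have "(norm (u + 2 / u - of_real A))\<^sup>2 = (x + 2 * x / m - A)\<^sup>2 + (y - 2 * y / m)\<^sup>2"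
    by (simp add: cmod_power2)
  also have "\<dots> = (x\<^sup>2 + y\<^sup>2) * (1 + 4 / m\<^sup>2) + 4 * (x\<^sup>2 - y\<^sup>2) / m - 2 * A * x * (1 + 2 / m) + A\<^sup>2"
    by (simp add: power2_eq_square algebra_simps add_divide_distrib diff_divide_distrib)
  also have "x\<^sup>2 - y\<^sup>2 = 2 * x\<^sup>2 - m"
    by (simp add: m)
  also have "(x\<^sup>2 + y\<^sup>2) * (1 + 4 / m\<^sup>2) = m + 4 / m"
    unfolding m[symmetric] using m0 by (simp add: power2_eq_square field_simps)
  also have "x = (m + 2 * e) / 2"
    using circle by simp
  also have "m + 4 / m + 4 * (2 * ((m + 2 * e) / 2)\<^sup>2 - m) / m - 2 * A * ((m + 2 * e) / 2) * (1 + 2 / m) + A\<^sup>2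
      = G m"
    using m0 unfolding G_def by (simp add: power2_eq_square field_simps)
  finally have norm: "(norm (u + 2 / u - of_real A))\<^sup>2 = G m" .
  have "(4 + 8 * e\<^sup>2 - 4 * e * A) / 2 = 6 - 8 * e - 2 * e * A"
    by (simp add: e(2))
  \<comment> \<open>At \<open>m = 2\<close> the value of \<open>G\<close> is the squared distance
    from the centre to \<open>2 * sqrt 2 - 2\<close>, at \<open>m = 2 - 4 * e\<close> the squared
    distance to 2.\<close>
  then have G2: "G 2 = (A - (2 * e + 2))\<^sup>2"
    unfolding G_def using e(2) by algebra
  have "(2 - 4 * e) * (14 + 4 * e - 2 * A * (e + 2)) = 4 + 8 * e\<^sup>2 - 4 * e * A"
    using e(2) by algebra
  then have "(4 + 8 * e\<^sup>2 - 4 * e * A) / (2 - 4 * e) = 14 + 4 * e - 2 * A * (e + 2)"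
    using e12 by (simp add: field_simps)
  then have G4: "G (2 - 4 * e) = (4 - A)\<^sup>2"
    unfolding G_def by (simp add: power2_eq_square algebra_simps)
  \<comment> \<open>Once \<open>m - m'\<close> is split off, the remaining numerator is linear in
    \<open>m\<close>, so comparing \<open>G\<close> with an end value becomes a sign question for a
    linear expression.\<close>
  have diff: "G m - G m' = (m - m') * ((3 - A) * (m * m') - (4 + 8 * e\<^sup>2 - 4 * e * A)) / (m * m')"
    if "0 < m'" for m'
    using m0 that unfolding G_def by (simp add: divide_simps) (simp add: algebra_simps)
  \<comment> \<open>The threshold \<open>A = 3 + e\<close> means \<open>a = sqrt 2\<close>, the
    midpoint of the two boundary points; each case compares with the nearer one.\<close>
  consider "A \<le> 3 + e" | "3 + e \<le> A" by linarith
  then show ?thesis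
  proof cases
    case 1
    \<comment> \<open>The left side is linear in \<open>m\<close> with slope of the sign of
      \<open>3 - A\<close>, so it is largest at \<open>m = 2\<close> or at
      \<open>m = 2 - 4 * e\<close>. The first case then follows from \<open>2 * e + 2 < A\<close>,
      the second from \<open>A \<le> 3 + e\<close>.\<close>
    have "(3 - A) * (m * 2) \<le> 4 + 8 * e\<^sup>2 - 4 * e * A"
    proof (cases "A \<le> 3")
      case True
      then have "(3 - A) * (m * 2) \<le> (3 - A) * 4"
        using mb by (intro mult_left_mono) auto
      moreover have "(2 + 2 * e) * (1 - e) \<le> A * (1 - e)"
        using assms(2) e12 by (intro mult_right_mono) (auto simp: A_def e_def)
      moreover have "(2 + 2 * e) * (1 - e) = 4 * e"
        using e(2) by algebra
      ultimately show ?thesis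
        unfolding e(2) by (simp add: algebra_simps)
    next
      case False
      then have "(3 - A) * (m * 2) \<le> (3 - A) * ((2 - 4 * e) * 2)"
        using mb by (intro mult_left_mono_neg) auto
      moreover have "A * (3 * e - 1) \<le> (3 + e) * (3 * e - 1)"
        using 1 e12 by (intro mult_right_mono) auto
      moreover have "(3 + e) * (3 * e - 1) = 2 * e"
        using e(2) by algebra
      ultimately show ?thesis
        unfolding e(2) by (simp add: algebra_simps)
    qed
    then have "0 \<le> (m - 2) * ((3 - A) * (m * 2) - (4 + 8 * e\<^sup>2 - 4 * e * A)) / (m * 2)"
      using mb m0 by (intro divide_nonneg_pos mult_nonpos_nonpos) auto
    then have "(A - (2 * e + 2))\<^sup>2 \<le> (norm (u + 2 / u - of_real A))\<^sup>2"
      using diff[of 2] unfolding norm G2 by linarith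
    then have "A - (2 * e + 2) \<le> norm (u + 2 / u - of_real A)"
      by (rule power2_le_imp_le) simp
    then show ?thesis
      by (simp add: A_def e_def algebra_simps)
  next
    case 2
    \<comment> \<open>Now \<open>3 - A\<close> is negative, so \<open>m = 2\<close> is the worst
      case, where the required inequality reduces to \<open>3 + e \<le> A\<close>.\<close>
    have "(3 + e) * (3 * e - 1) \<le> A * (3 * e - 1)"
      using 2 e12 by (intro mult_right_mono) auto
    moreover have "(3 + e) * (3 * e - 1) = 2 * e"
      using e(2) by algebra
    moreover have "(3 - A) * ((2 - 4 * e) * 2) \<le> (3 - A) * ((2 - 4 * e) * m)"
      using mb 2 e12 by (intro mult_left_mono_neg mult_left_mono) auto
    ultimately have "4 + 8 * e\<^sup>2 - 4 * e * A \<le> (3 - A) * (m * (2 - 4 * e))"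
      unfolding e(2) by (simp add: algebra_simps)
    then have "0 \<le> (m - (2 - 4 * e)) * ((3 - A) * (m * (2 - 4 * e)) - (4 + 8 * e\<^sup>2 - 4 * e * A))
        / (m * (2 - 4 * e))"
      using mb m0 e12 by (intro divide_nonneg_pos mult_nonneg_nonneg) auto
    then have "(4 - A)\<^sup>2 \<le> (norm (u + 2 / u - of_real A))\<^sup>2"
      using diff[of "2 - 4 * e"] e12 unfolding norm G4 by linarith
    then have "4 - A \<le> norm (u + 2 / u - of_real A)"
      by (rule power2_le_imp_le) simp
    then show ?thesis
      by (simp add: A_def algebra_simps)
  qed
qed

lemma \<phi>_R_denominators:
  fixes z :: complex
  assumes "norm z \<le> 1"
  shows "z \<noteq> of_real (sqrt 2 + 1)" "1 - of_real (sqrt 2 - 1) * z \<noteq> 0"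
proof -
  have e: "0 < sqrt 2 - (1::real)" "sqrt 2 - 1 < (1::real)"
    using sqrt_2_less by auto
  have "norm (complex_of_real (sqrt 2 + 1)) = sqrt 2 + 1"
    unfolding norm_of_real by simp
  then show "z \<noteq> of_real (sqrt 2 + 1)"
    using assms e by auto
  have "norm (of_real (sqrt 2 - 1) * z) = (sqrt 2 - 1) * norm z"
    unfolding norm_mult norm_of_real using e by simp
  also have "\<dots> \<le> sqrt 2 - 1"
    using e assms by (simp add: mult_left_le)
  finally have "norm (of_real (sqrt 2 - 1) * z) < 1"
    using e by simp
  then show "1 - of_real (sqrt 2 - 1) * z \<noteq> 0"
    by auto
qed

lemma \<phi>_R_holomorphic: "\<phi>_R holomorphic_on cball 0 1"
proof -
  have "(complex_of_real (sqrt 2 + 1))\<^sup>2 - complex_of_real (sqrt 2 + 1) * z \<noteq> 0"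
    if "norm z \<le> 1" for z
  proof -
    have "complex_of_real (sqrt 2 + 1) \<noteq> 0"
      unfolding of_real_eq_0_iff by (smt (verit) real_sqrt_ge_zero)
    moreover have "complex_of_real (sqrt 2 + 1) - z \<noteq> 0"
      using \<phi>_R_denominators(1)[OF that] by simp
    ultimately have "complex_of_real (sqrt 2 + 1) * (complex_of_real (sqrt 2 + 1) - z) \<noteq> 0"
      by (rule no_zero_divisors)
    then show ?thesis
      by (simp only: power2_eq_square right_diff_distrib not_False_eq_True)
  qed
  then show ?thesis
    unfolding \<phi>_R_def Let_def by (intro holomorphic_intros) auto
qed

lemma norm_\<phi>_R_denominator_less:
  fixes z :: complex
  assumes "norm z < 1"
  shows "norm (1 - of_real (sqrt 2 - 1) * z) < sqrt 2"
proof -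
  define e where "e = sqrt (2::real) - 1"
  have e: "0 < e" by (simp add: e_def)
  have "norm (1 - of_real e * z) \<le> 1 + e * norm z"
    using norm_triangle_ineq4[of 1 "of_real e * z"] e unfolding norm_mult norm_of_real by simp
  also have "\<dots> < 1 + e * 1"
    using assms e by (intro add_strict_left_mono mult_strict_left_mono) auto
  finally show ?thesis by (simp add: e_def)
qed

text \<open>The map \<open>u + 2 / u\<close> takes equal values at distinct \<open>u\<close> and
  \<open>v\<close> only if \<open>u * v = 2\<close>, which is impossible when both norms are below
  \<open>sqrt 2\<close>.\<close>

lemma \<phi>_R_inj: "inj_on \<phi>_R unit_disk"
proof (rule inj_onI)
  fix z w assume zw: "z \<in> unit_disk" "w \<in> unit_disk" "\<phi>_R z = \<phi>_R w"
  define u v e where "u = 1 - of_real (sqrt 2 - 1) * z" and "v = 1 - of_real (sqrt 2 - 1) * w"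
    and "e = sqrt (2::real) - 1"
  have e: "0 < e" by (simp add: e_def)
  have "norm u < sqrt 2" "norm v < sqrt 2"
    using norm_\<phi>_R_denominator_less zw by (auto simp: u_def v_def)
  then have "norm (u * v) < sqrt 2 * sqrt 2"
    unfolding norm_mult by (intro mult_strict_mono) auto
  then have uv: "u * v \<noteq> 2" by auto
  have k: "z \<noteq> of_real (sqrt 2 + 1)" "w \<noteq> of_real (sqrt 2 + 1)" "u \<noteq> 0" "v \<noteq> 0"
    using \<phi>_R_denominators[of z] \<phi>_R_denominators[of w] zw(1,2) by (auto simp: u_def v_def)
  then have "u + 2 / u = v + 2 / v"
    using zw(3) by (simp add: \<phi>_R_eq u_def v_def)
  then have "(u - v) * (u * v - 2) = 0"
    using k by (simp add: field_simps)
  then have "u = v" using uv by simp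
  then show "z = w"
    using e by (simp add: u_def v_def e_def)
qed

text \<open>A connectedness argument. By the intermediate value theorem the centre is a value at a
  real point, so a disk not contained in the image would meet its frontier. The image is open and
  its closure lies in the image of the closed disk, so frontier points are values on the unit
  circle; \<open>joukowski_circle_dist\<close> keeps these farther than \<open>\<rho>\<close> from
  \<open>a\<close>.\<close>

lemma cball_subset_\<phi>_R_image:
  fixes a \<rho> :: real
  assumes "2 * sqrt 2 - 2 < a - \<rho>" "a + \<rho> < 2" "0 \<le> \<rho>"
  shows "cball (of_real a) \<rho> \<subseteq> \<phi>_R ` unit_disk"
proof (rule ccontr)
  assume not_subset: "\<not> ?thesis"
  define e where "e = sqrt (2::real) - 1"
  have e: "0 < e" "e < 1" "e\<^sup>2 = 1 - 2 * e"
    using sqrt_2_less by (auto simp: e_def power2_eq_square algebra_simps)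
  have "of_real a \<in> \<phi>_R ` unit_disk"
  proof -
    define g where "g = (\<lambda>x. (1 - e * x) + 2 / (1 - e * x) - 2)"
    have ex: "1 - e * x \<noteq> 0" if "-1 \<le> x" "x \<le> 1" for x
    proof -
      have "e * x \<le> e"
        using that e(1) by (simp add: mult_left_le)
      then show ?thesis
        using e(2) by linarith
    qed
    have "2 / (1 + e) = 1 + e" "2 / (1 - e) = 3 + e"
      using e by (auto simp: divide_simps power2_eq_square algebra_simps)
    then have g: "g (-1) = 2 * sqrt 2 - 2" "g 1 = 2"
      by (auto simp: g_def e_def)
    have "continuous_on {-1..1} g"
      unfolding g_def using ex by (intro continuous_intros) auto
    then obtain x where x: "-1 \<le> x" "x \<le> 1" "g x = a"
      using IVT'[of g "-1" a 1] assms g by auto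
    then have "x \<noteq> -1" "x \<noteq> 1"
      using g assms by auto
    then have "of_real x \<in> unit_disk"
      using x by auto
    moreover from this have "\<phi>_R (of_real x) = of_real (g x)"
      using \<phi>_R_denominators(1)[of "of_real x"] by (simp add: \<phi>_R_eq g_def e_def)
    ultimately show ?thesis
      using x(3) by (metis imageI)
  qed
  moreover have "of_real a \<in> cball (of_real a :: complex) \<rho>"
    using assms(3) by simp
  ultimately have "cball (of_real a) \<rho> \<inter> \<phi>_R ` unit_disk \<noteq> {}"
    by blast
  moreover have "cball (of_real a) \<rho> - \<phi>_R ` unit_disk \<noteq> {}"
    using not_subset by (simp add: Diff_eq_empty_iff)
  ultimately have "cball (of_real a) \<rho> \<inter> frontier (\<phi>_R ` unit_disk) \<noteq> {}"
    by (intro connected_Int_frontier) auto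
  then obtain v where v: "v \<in> cball (of_real a) \<rho>" "v \<in> frontier (\<phi>_R ` unit_disk)"
    by blast
  have hol: "\<phi>_R holomorphic_on unit_disk"
    using holomorphic_on_subset[OF \<phi>_R_holomorphic] by auto
  have "open (\<phi>_R ` unit_disk)"
    by (rule open_mapping_thm3[OF hol open_ball \<phi>_R_inj])
  then have "v \<notin> \<phi>_R ` unit_disk"
    using v(2) by (simp add: frontier_def interior_open)
  have "closure (\<phi>_R ` unit_disk) \<subseteq> \<phi>_R ` cball 0 1"
    using compact_continuous_image[OF holomorphic_on_imp_continuous_on[OF \<phi>_R_holomorphic]] by (intro closure_minimal) (auto intro: compact_imp_closed)
  then obtain z where z: "norm z \<le> 1" "v = \<phi>_R z"
    using v(2) by (auto simp: frontier_def)
  then have "norm z = 1"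
    using \<open>v \<notin> \<phi>_R ` unit_disk\<close> by (cases "norm z < 1") auto
  define u where "u = 1 - of_real e * z"
  have "norm (u - 1) = sqrt 2 - 1"
  proof -
    have "norm (u - 1) = norm (of_real e * z)"
      by (simp add: u_def)
    also have "\<dots> = e"
      unfolding norm_mult norm_of_real using \<open>norm z = 1\<close> e(1) by simp
    finally show ?thesis by (simp add: e_def)
  qed
  then have "min (a - (2 * sqrt 2 - 2)) (2 - a) \<le> norm (u + 2 / u - 2 - of_real a)"
    using assms by (intro joukowski_circle_dist) auto
  also have "u + 2 / u - 2 = v"
    using \<phi>_R_denominators(1)[OF z(1)] z(2) by (simp add: \<phi>_R_eq u_def e_def)
  also have "norm (v - of_real a) \<le> \<rho>"
    using v(1) by (simp add: dist_norm norm_minus_commute)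
  finally show False
    using assms by auto
qed


text \<open>Solve for \<open>u\<close>. The value 2 forces \<open>u = 2 - sqrt 2\<close>, which is
  \<open>z = 1\<close>, or \<open>u = 2 + sqrt 2\<close>. The value \<open>2 * sqrt 2 - 2\<close> is
  a critical value and forces the double root \<open>u = sqrt 2\<close>. The last two violate
  \<open>norm u < sqrt 2\<close>.\<close>

lemma \<phi>_R_omits:
  "2 \<notin> \<phi>_R ` unit_disk" "of_real (2 * sqrt 2 - 2) \<notin> \<phi>_R ` unit_disk"
proof -
  define s :: complex where "s = of_real (sqrt 2)"
  have s: "s * s = 2"
    unfolding s_def of_real_mult[symmetric] by simp
  have ns: "norm s = sqrt 2"
    by (simp add: s_def)
  have False if z: "norm z < 1" "\<phi>_R z = 2 \<or> \<phi>_R z = of_real (2 * sqrt 2 - 2)" for z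
  proof -
    define u where "u = 1 - of_real (sqrt 2 - 1) * z"
    have u: "u \<noteq> 0" "norm u < sqrt 2" "\<phi>_R z = u + 2 / u - 2"
      using z(1) \<phi>_R_denominators[of z] norm_\<phi>_R_denominator_less[of z]
      by (auto simp: \<phi>_R_eq u_def)
    from z(2) show False
    proof
      assume "\<phi>_R z = 2"
      then have "u * u - 4 * u + 2 = 0"
        using u by (simp add: field_simps)
      then have "(u - (2 - s)) * (u - (2 + s)) = 0"
        using s by algebra
      then consider "u = 2 - s" | "u = 2 + s" by auto
      then show False
      proof cases
        case 1
        then have "(s - 1) * (z - 1) = 0"
          by (simp add: u_def s_def algebra_simps)
        moreover have "s \<noteq> 1"
          using s by auto
        ultimately show False
          using z(1) by auto
      next
        case 2
        then have "u = of_real (2 + sqrt 2)"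
          by (simp add: s_def)
        then have "norm u = \<bar>2 + sqrt 2\<bar>"
          by (simp only: norm_of_real)
        then show False
          using u(2) by simp
      qed
    next
      assume "\<phi>_R z = of_real (2 * sqrt 2 - 2)"
      then have "u * u + 2 = 2 * s * u"
        using u by (simp add: field_simps s_def)
      then have "(u - s) * (u - s) = 0"
        using s by algebra
      then show False
        using u(2) ns by auto
    qed
  qed
  then show "2 \<notin> \<phi>_R ` unit_disk" "of_real (2 * sqrt 2 - 2) \<notin> \<phi>_R ` unit_disk"
    by force+
qed

section \<open>Disks containing the values of \<open>z * F' / F\<close>\<close>

text \<open>The map \<open>1 / (1 - w)\<close> sends the disk of radius \<open>r\<close> onto the
  disk with diameter from \<open>1 / (1 + r)\<close> to \<open>1 / (1 - r)\<close>. With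
  denominators cleared the bound is \<open>norm (w - r^2) \<le> r * norm (1 - w)\<close>, whose
  square reduces to \<open>norm w \<le> r\<close>.\<close>

lemma inverse_disk_bound:
  fixes w :: complex and r :: real
  assumes "norm w \<le> r" "r < 1"
  shows "norm (1 / (1 - w) - of_real (1 / (1 - r\<^sup>2))) \<le> r / (1 - r\<^sup>2)"
proof -
  have r: "0 \<le> r" "r\<^sup>2 < 1"
    using assms order_trans[OF norm_ge_zero assms(1)] by (auto simp: abs_square_less_1)
  have "w \<noteq> 1" using assms by auto
  have "(norm w)\<^sup>2 \<le> r\<^sup>2"
    using assms by (intro power_mono) auto
  then have "(norm w)\<^sup>2 * (1 - r\<^sup>2) \<le> r\<^sup>2 * (1 - r\<^sup>2)"
    using r by (intro mult_right_mono) auto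
  then have "(norm (w - of_real (r\<^sup>2)))\<^sup>2 \<le> (r * norm (1 - w))\<^sup>2"
    unfolding power_mult_distrib cmod_power2 by (simp add: power2_eq_square algebra_simps)
  then have *: "norm (w - of_real (r\<^sup>2)) \<le> r * norm (1 - w)"
    by (rule power2_le_imp_le) (simp add: r(1))
  have "of_real (1 - r\<^sup>2) \<noteq> (0::complex)"
    unfolding of_real_eq_0_iff using r(2) by simp
  then have "1 / (1 - w) - of_real (1 / (1 - r\<^sup>2)) = (w - of_real (r\<^sup>2)) / ((1 - w) * of_real (1 - r\<^sup>2))"
    using \<open>w \<noteq> 1\<close> unfolding of_real_divide by (simp add: diff_frac_eq)
  also have "norm \<dots> = norm (w - of_real (r\<^sup>2)) / (norm (1 - w) * (1 - r\<^sup>2))"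
    unfolding norm_divide norm_mult norm_of_real using r(2) by simp
  also have "\<dots> \<le> r * norm (1 - w) / (norm (1 - w) * (1 - r\<^sup>2))"
    using * r(2) by (intro divide_right_mono) auto
  also have "\<dots> = r / (1 - r\<^sup>2)"
    using \<open>w \<noteq> 1\<close> by simp
  finally show ?thesis .
qed

text \<open>Write \<open>g = z * q\<close> with \<open>q\<close> holomorphic and zero-free on the
  disk; the quotient is then \<open>1 + z * q' / q\<close>, which also reproduces the conventional
  value 1 at 0.\<close>

lemma starlike_quot_holomorphic:
  assumes "g \<in> class_A" "\<And>z. z \<in> unit_disk - {0} \<Longrightarrow> g z \<noteq> 0"
  shows "starlike_quot g holomorphic_on unit_disk"
proof -
  define q where "q = (\<lambda>z. if z = 0 then 1 else g z / z)"
  have g: "g holomorphic_on unit_disk" "g 0 = 0" "deriv g 0 = 1"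
    using assms(1) by (auto simp: class_A_def)
  have q: "q holomorphic_on unit_disk"
    by (rule pole_theorem_0[OF g(1), of 0]) (auto simp: q_def g)

  have q0: "q z \<noteq> 0" if "z \<in> unit_disk" for z
    using assms(2) that g by (auto simp: q_def)
  have eq: "starlike_quot g z = 1 + z * deriv q z / q z" if z: "z \<in> unit_disk" for z
  proof (cases "z = 0")
    case False
    have gq: "g z = z * q z" for z
      by (simp add: q_def g)
    have "deriv g z = deriv (\<lambda>z. z * q z) z"
      by (simp only: gq[abs_def])
    also have "\<dots> = q z + z * deriv q z"
      using holomorphic_derivI[OF q open_ball z]
      by (intro DERIV_imp_deriv) (auto intro!: derivative_eq_intros)
    finally have "deriv g z = q z + z * deriv q z" .
    then show ?thesis
      using False q0[OF z] gq[of z] by (simp add: starlike_quot_def divide_simps)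
  qed (simp add: starlike_quot_def)
  have "(\<lambda>z. 1 + z * deriv q z / q z) holomorphic_on unit_disk"
    using q0 by (intro holomorphic_intros q) auto
  then show ?thesis
    by (rule holomorphic_transform) (rule eq[symmetric])
qed

text \<open>A Moebius map takes the half-plane \<open>Re p > \<alpha>\<close> to the unit disk and 1
  to 0, so the Schwarz lemma bounds \<open>w\<close>. Solving for \<open>p\<close> makes it an
  affine function of \<open>1 / (1 - w)\<close>, to which \<open>inverse_disk_bound\<close>
  applies.\<close>

lemma ST_starlike_quot_disk:
  assumes "f \<in> ST \<alpha>" "\<alpha> < 1" "norm z < 1"
  shows "norm (starlike_quot f z - of_real (1 + 2 * (1 - \<alpha>) * (norm z)\<^sup>2 / (1 - (norm z)\<^sup>2)))
           \<le> 2 * (1 - \<alpha>) * norm z / (1 - (norm z)\<^sup>2)"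
proof -
  define p where "p = starlike_quot f"
  define w where "w = (\<lambda>z. (p z - 1) / (p z + 1 - 2 * of_real \<alpha>))"
  have p: "p holomorphic_on unit_disk" "p 0 = 1"
    using assms(1) starlike_quot_holomorphic[of f] by (auto simp: p_def ST_def starlike_quot_def)
  have Re: "Re (p z) > \<alpha>" if "norm z < 1" for z
    using assms(1) that by (auto simp: p_def ST_def)
  have nz: "p z + 1 - 2 * of_real \<alpha> \<noteq> 0" if "norm z < 1" for z
    using Re[OF that] assms(2) by (auto simp: complex_eq_iff)
  have "norm (w z) < 1" if "norm z < 1" for z
  proof -
    \<comment> \<open>Four times this product is the difference of the two squared norms compared
      next.\<close>
    have "0 < (1 - \<alpha>) * (Re (p z) - \<alpha>)"
      using Re[OF that] assms(2) by simp
    then have "(norm (p z - 1))\<^sup>2 < (norm (p z + 1 - 2 * of_real \<alpha>))\<^sup>2"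
      unfolding cmod_power2 by (simp add: power2_eq_square algebra_simps)
    then have "norm (p z - 1) < norm (p z + 1 - 2 * of_real \<alpha>)"
      by (rule power2_less_imp_less) simp
    then show ?thesis
      using nz[OF that] by (simp add: w_def norm_divide)
  qed
  then have "norm (w z) \<le> norm z"
    using assms(3) p nz by (intro Schwarz_Lemma(1)) (auto simp: w_def intro!: holomorphic_intros)
  then have *: "norm (1 / (1 - w z) - of_real (1 / (1 - (norm z)\<^sup>2))) \<le> norm z / (1 - (norm z)\<^sup>2)"
    using assms(3) by (intro inverse_disk_bound)
  have z2: "(norm z)\<^sup>2 < 1"
    using assms(3) by (simp add: abs_square_less_1)
  have "1 - w z = 2 * (1 - of_real \<alpha>) / (p z + 1 - 2 * of_real \<alpha>)"
    using nz[OF assms(3)] by (simp add: w_def field_simps)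
  moreover have "1 - of_real \<alpha> \<noteq> (0::complex)"
    using assms(2) by (auto simp: complex_eq_iff)
  ultimately have "2 * (1 - of_real \<alpha>) * (1 / (1 - w z)) = p z + 1 - 2 * of_real \<alpha>"
    by simp
  then have "p z = 1 + 2 * (1 - of_real \<alpha>) * (1 / (1 - w z) - 1)"
    by (simp add: algebra_simps)
  moreover have "1 + 2 * (1 - \<alpha>) * (norm z)\<^sup>2 / (1 - (norm z)\<^sup>2) =
      1 + 2 * (1 - \<alpha>) * (1 / (1 - (norm z)\<^sup>2) - 1)"
    using z2 by (simp add: field_simps)
  moreover have "1 + 2 * (1 - of_real \<alpha>) * (u - 1) - of_real (1 + 2 * (1 - \<alpha>) * (v - 1)) =
      of_real (2 * (1 - \<alpha>)) * (u - of_real v)" for u :: complex and v :: real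
    by (simp add: algebra_simps)
  ultimately have "p z - of_real (1 + 2 * (1 - \<alpha>) * (norm z)\<^sup>2 / (1 - (norm z)\<^sup>2)) =
      of_real (2 * (1 - \<alpha>)) * (1 / (1 - w z) - of_real (1 / (1 - (norm z)\<^sup>2)))"
    by (simp only:)
  also have "norm \<dots> = 2 * (1 - \<alpha>) * norm (1 / (1 - w z) - of_real (1 / (1 - (norm z)\<^sup>2)))"
    using assms(2) by (simp only: norm_mult norm_of_real) simp
  also have "\<dots> \<le> 2 * (1 - \<alpha>) * (norm z / (1 - (norm z)\<^sup>2))"
    using assms(2) * by (intro mult_left_mono) auto
  finally show ?thesis by (simp add: p_def)
qed

text \<open>Roots are split off one at a time. A zero \<open>x\<close> contributes
  \<open>z / (z - x) = 1 - 1 / (1 - z / x)\<close> to the logarithmic derivative; since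
  \<open>norm (z / x) \<le> norm z\<close>, every contribution lies in the same disk, and centres
  and radii add up.\<close>

lemma poly_log_deriv_disk:
  fixes Q :: "complex poly"
  assumes "\<And>x. poly Q x = 0 \<Longrightarrow> 1 \<le> norm x" "norm z < 1"
  shows "norm (z * poly (pderiv Q) z / poly Q z
               + of_real (real (degree Q) * (norm z)\<^sup>2 / (1 - (norm z)\<^sup>2)))
           \<le> real (degree Q) * norm z / (1 - (norm z)\<^sup>2)"
  using assms(1)
proof (induction "degree Q" arbitrary: Q)
  case 0
  then have "pderiv Q = 0"
    by (simp add: pderiv_eq_0_iff)
  then show ?case
    using 0(1)[symmetric] by simp
next
  case (Suc n)
  obtain x where x: "poly Q x = 0"
    using alg_closed_imp_poly_has_root[of Q] Suc(2) by auto
  then obtain P where P: "Q = [:-x, 1:] * P"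
    by (auto simp: poly_eq_0_iff_dvd)
  have "P \<noteq> 0"
    using P Suc(2) by auto
  then have deg: "n = degree P"
    using Suc(2) degree_mult_eq[of "[:-x, 1:]" P] unfolding P by simp
  have IH: "norm (z * poly (pderiv P) z / poly P z
        + of_real (real (degree P) * (norm z)\<^sup>2 / (1 - (norm z)\<^sup>2)))
      \<le> real (degree P) * norm z / (1 - (norm z)\<^sup>2)"
  proof (rule Suc.hyps(1)[OF deg])
    show "1 \<le> norm y" if "poly P y = 0" for y
      using Suc.prems[of y] that by (simp add: P)
  qed
  have nx: "1 \<le> norm x"
    using Suc.prems x by blast
  then have "x \<noteq> 0" "z \<noteq> x" using assms(2) by auto
  have nP: "poly P z \<noteq> 0"
    using Suc.prems[of z] assms(2) P by auto
  have z2: "(norm z)\<^sup>2 < 1"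
    using assms(2) by (simp add: abs_square_less_1)
  have "norm (z / x) \<le> norm z"
    using nx by (simp add: norm_divide divide_le_eq mult_le_cancel_left1)
  then have *: "norm (1 / (1 - z / x) - of_real (1 / (1 - (norm z)\<^sup>2))) \<le> norm z / (1 - (norm z)\<^sup>2)"
    using assms(2) by (intro inverse_disk_bound)
  have eq1: "z * poly (pderiv Q) z / poly Q z = z / (z - x) + z * poly (pderiv P) z / poly P z"
    unfolding P pderiv_mult using \<open>z \<noteq> x\<close> nP by (simp add: pderiv_pCons field_simps)
  have eq2: "z / (z - x) = 1 - 1 / (1 - z / x)"
    using \<open>x \<noteq> 0\<close> \<open>z \<noteq> x\<close> by (simp add: field_simps)
  have eq3: "(norm z)\<^sup>2 / (1 - (norm z)\<^sup>2) = 1 / (1 - (norm z)\<^sup>2) - 1"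
    using z2 by (simp add: field_simps)
  have "z * poly (pderiv Q) z / poly Q z
      + of_real (real (degree Q) * (norm z)\<^sup>2 / (1 - (norm z)\<^sup>2)) =
      (z * poly (pderiv P) z / poly P z
        + of_real (real (degree P) * (norm z)\<^sup>2 / (1 - (norm z)\<^sup>2)))
      - (1 / (1 - z / x) - of_real (1 / (1 - (norm z)\<^sup>2)))"
  proof -
    have "1 - u + v + of_real (real (Suc n) * (t - 1)) =
        (v + of_real (real n * (t - 1))) - (u - of_real t)" for u v :: complex and t :: real
      by (simp add: algebra_simps)
    then show ?thesis
      unfolding eq1 eq2 Suc(2)[symmetric] deg[symmetric]
        times_divide_eq_right[of _ "(norm z)\<^sup>2", symmetric] eq3
      by blast
  qed
  also have "norm \<dots> \<le> real (degree P) * norm z / (1 - (norm z)\<^sup>2) + norm z / (1 - (norm z)\<^sup>2)"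
    by (rule order_trans[OF norm_triangle_ineq4 add_mono[OF IH *]])
  also have "\<dots> = real (degree Q) * norm z / (1 - (norm z)\<^sup>2)"
    unfolding Suc(2)[symmetric] deg[symmetric] by (simp add: add_divide_distrib algebra_simps)
  finally show ?case .
qed

text \<open>Logarithmic differentiation: products turn into sums, and differentiating
  \<open>exp L = Q\<close> gives \<open>L' = Q' / Q\<close>.\<close>

lemma starlike_quot_mult_power_branch:
  fixes F f h :: "complex \<Rightarrow> complex" and Q :: "complex poly" and c :: real
  assumes "f \<in> class_A" "\<And>z. z \<in> unit_disk - {0} \<Longrightarrow> f z \<noteq> 0"
    and "is_power_branch (poly Q) c h" "\<And>z. z \<in> unit_disk \<Longrightarrow> F z = f z * h z"
  shows "F \<in> class_A" "\<And>z. z \<in> unit_disk - {0} \<Longrightarrow> F z \<noteq> 0"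
    and "\<And>z. z \<in> unit_disk \<Longrightarrow> starlike_quot F z =
           starlike_quot f z + of_real c * (z * poly (pderiv Q) z / poly Q z)"
proof -
  note F = assms(4)
  obtain L where L: "L holomorphic_on unit_disk" "L 0 = 0"
      "\<And>z. z \<in> unit_disk \<Longrightarrow> exp (L z) = poly Q z"
      "\<And>z. z \<in> unit_disk \<Longrightarrow> h z = exp (of_real c * L z)"
    using assms(3) unfolding is_power_branch_def by blast
  have f': "f holomorphic_on unit_disk" "f 0 = 0" "deriv f 0 = 1"
    using assms(1) by (auto simp: class_A_def)
  \<comment> \<open>\<open>F\<close> and \<open>h\<close> are prescribed on the disk only, so
    derivatives are computed for this explicit product and transferred along the open disk.\<close>
  define G where "G = (\<lambda>z. f z * exp (of_real c * L z))"
  have FG: "F z = G z" if "z \<in> unit_disk" for z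
    using that F L(4) by (simp add: G_def)
  have G: "G holomorphic_on unit_disk"
    unfolding G_def by (intro holomorphic_intros f' L)
  have Fh: "F holomorphic_on unit_disk"
    using G FG by (metis holomorphic_transform)
  have dF: "deriv F z = deriv f z * exp (of_real c * L z)
      + f z * (exp (of_real c * L z) * (of_real c * deriv L z))" if z: "z \<in> unit_disk" for z
  proof -
    have "deriv F z = deriv G z"
      by (rule complex_derivative_transform_within_open[OF Fh G open_ball z FG])
    also have "\<dots> = deriv f z * exp (of_real c * L z)
      + f z * (exp (of_real c * L z) * (of_real c * deriv L z))"
      unfolding G_def
      using holomorphic_derivI[OF f'(1) open_ball z] holomorphic_derivI[OF L(1) open_ball z]
      by (intro DERIV_imp_deriv) (auto intro!: derivative_eq_intros)
    finally show ?thesis .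
  qed
  have Q0: "poly Q z \<noteq> 0" if "z \<in> unit_disk" for z
    using L(3)[OF that] by (metis exp_not_eq_zero)
  have dL: "deriv L z = poly (pderiv Q) z / poly Q z" if z: "z \<in> unit_disk" for z
  proof -
    have "deriv (\<lambda>z. exp (L z)) z = deriv (poly Q) z"
      by (rule complex_derivative_transform_within_open[OF _ _ open_ball z])
         (auto intro!: holomorphic_intros L simp: L(3))
    moreover have "deriv (\<lambda>z. exp (L z)) z = exp (L z) * deriv L z"
      using holomorphic_derivI[OF L(1) open_ball z]
      by (intro DERIV_imp_deriv) (auto intro!: derivative_eq_intros)
    moreover have "deriv (poly Q) z = poly (pderiv Q) z"
      by (intro DERIV_imp_deriv poly_DERIV)
    ultimately show ?thesis
      using L(3)[OF z] Q0[OF z] by (simp add: field_simps)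
  qed
  show "F \<in> class_A"
    using Fh FG[of 0] dF[of 0] f' L(2) by (simp add: class_A_def G_def)
  show "F z \<noteq> 0" if "z \<in> unit_disk - {0}" for z
    using that assms(2) FG by (simp add: G_def)
  show "starlike_quot F z =
      starlike_quot f z + of_real c * (z * poly (pderiv Q) z / poly Q z)"
    if z: "z \<in> unit_disk" for z
    using assms(2)[of z] z
    by (auto simp: starlike_quot_def FG G_def dF dL field_simps Q0)
qed

lemma family_F_properties:
  assumes "F \<in> family_F \<alpha> \<beta> n"
  shows "F \<in> class_A" "\<And>z. z \<in> unit_disk - {0} \<Longrightarrow> F z \<noteq> 0"
    and "\<exists>f Q. f \<in> ST \<alpha> \<and> degree Q = n \<and> (\<forall>z. poly Q z = 0 \<longrightarrow> 1 \<le> norm z) \<and>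
           (\<forall>z\<in>unit_disk. starlike_quot F z =
              starlike_quot f z + of_real (\<beta> / real n) * (z * poly (pderiv Q) z / poly Q z))"
proof -
  from assms obtain f Q h where f: "f \<in> ST \<alpha>" and Q: "degree Q = n"
      "\<And>z. poly Q z = 0 \<Longrightarrow> z \<notin> unit_disk" and h: "is_power_branch (poly Q) (\<beta> / real n) h"
      and F: "\<And>z. z \<in> unit_disk \<Longrightarrow> F z = f z * h z"
    unfolding family_F_def by blast
  have f': "f \<in> class_A" "\<And>z. z \<in> unit_disk - {0} \<Longrightarrow> f z \<noteq> 0"
    using f by (auto simp: ST_def)
  note * = starlike_quot_mult_power_branch[OF f' h F]
  show "F \<in> class_A"
    using * by blast
  show "F z \<noteq> 0" if "z \<in> unit_disk - {0}" for z
    using * that by blast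
  have "1 \<le> norm z" if "poly Q z = 0" for z
    using Q(2)[OF that] by simp
  then show "\<exists>f Q. f \<in> ST \<alpha> \<and> degree Q = n \<and> (\<forall>z. poly Q z = 0 \<longrightarrow> 1 \<le> norm z) \<and>
           (\<forall>z\<in>unit_disk. starlike_quot F z =
              starlike_quot f z + of_real (\<beta> / real n) * (z * poly (pderiv Q) z / poly Q z))"
    using f Q(1) *(3) by blast
qed

text \<open>The disks for \<open>f\<close> and \<open>Q\<close> are added. The exponent
  \<open>\<beta> / n\<close> cancels the degree \<open>n\<close>, which makes the result independent
  of \<open>n\<close>.\<close>

lemma family_F_starlike_quot_disk:
  assumes "F \<in> family_F \<alpha> \<beta> n" "\<alpha> < 1" "0 < \<beta>" "1 \<le> n" "norm z < 1"
  shows "norm (starlike_quot F z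
               - of_real ((1 + (1 - 2 * \<alpha> - \<beta>) * (norm z)\<^sup>2) / (1 - (norm z)\<^sup>2)))
           \<le> (2 - 2 * \<alpha> + \<beta>) * norm z / (1 - (norm z)\<^sup>2)"
proof -
  define r where "r = norm z"
  obtain f Q where f: "f \<in> ST \<alpha>" and Q: "degree Q = n" "\<And>z. poly Q z = 0 \<Longrightarrow> 1 \<le> norm z"
    and eq: "starlike_quot F z =
        starlike_quot f z + of_real (\<beta> / real n) * (z * poly (pderiv Q) z / poly Q z)"
    using family_F_properties(3)[OF assms(1)] assms(5) by auto
  have r2: "r\<^sup>2 < 1"
    using assms(5) by (simp add: abs_square_less_1 r_def)
  have "(1 + (1 - 2 * \<alpha> - \<beta>) * r\<^sup>2) / (1 - r\<^sup>2) =
      (1 + 2 * (1 - \<alpha>) * r\<^sup>2 / (1 - r\<^sup>2)) - \<beta> / n * (n * r\<^sup>2 / (1 - r\<^sup>2))"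
    using r2 assms(4) by (simp add: divide_simps) (simp add: algebra_simps)
  moreover have "u + of_real t * v - of_real (A - t * B) =
      (u - of_real A) + of_real t * (v + of_real B)" for u v :: complex and t A B :: real
    by (simp add: algebra_simps)
  ultimately have "starlike_quot F z - of_real ((1 + (1 - 2 * \<alpha> - \<beta>) * r\<^sup>2) / (1 - r\<^sup>2)) =
      (starlike_quot f z - of_real (1 + 2 * (1 - \<alpha>) * r\<^sup>2 / (1 - r\<^sup>2))) +
      of_real (\<beta> / n) * (z * poly (pderiv Q) z / poly Q z + of_real (n * r\<^sup>2 / (1 - r\<^sup>2)))"
    by (simp only: eq)
  also have "norm \<dots> \<le> 2 * (1 - \<alpha>) * r / (1 - r\<^sup>2) + \<beta> / n * (n * r / (1 - r\<^sup>2))"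
  proof (rule norm_triangle_le, rule add_mono)
    show "norm (starlike_quot f z - of_real (1 + 2 * (1 - \<alpha>) * r\<^sup>2 / (1 - r\<^sup>2)))
        \<le> 2 * (1 - \<alpha>) * r / (1 - r\<^sup>2)"
      unfolding r_def by (rule ST_starlike_quot_disk[OF f assms(2,5)])
    have "norm (z * poly (pderiv Q) z / poly Q z + of_real (n * r\<^sup>2 / (1 - r\<^sup>2)))
        \<le> n * r / (1 - r\<^sup>2)"
      using poly_log_deriv_disk[of Q z, OF Q(2) assms(5)] unfolding r_def Q(1) by simp
    then show "norm (of_real (\<beta> / n) * (z * poly (pderiv Q) z / poly Q z
        + of_real (n * r\<^sup>2 / (1 - r\<^sup>2)))) \<le> \<beta> / n * (n * r / (1 - r\<^sup>2))"
      unfolding norm_mult norm_of_real using assms(3,4)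
      by (intro mult_mono) auto
  qed
  also have "\<dots> = (2 - 2 * \<alpha> + \<beta>) * r / (1 - r\<^sup>2)"
    using r2 assms(4) by (simp add: divide_simps) (simp add: algebra_simps)
  finally show ?thesis
    by (simp add: r_def)
qed

section \<open>Dilations and subordination to \<open>\<phi>_R\<close>\<close>

lemma deriv_dilate:
  fixes F :: "complex \<Rightarrow> complex" and r :: real
  assumes "F holomorphic_on unit_disk" "0 < r" "norm (of_real r * z) < 1"
  shows "deriv (\<lambda>z. F (of_real r * z) / of_real r) z = deriv F (of_real r * z)"
proof -
  have "of_real r * z \<in> unit_disk"
    using assms(3) by simp
  then have "(F has_field_derivative deriv F (of_real r * z)) (at (of_real r * z))"
    by (rule holomorphic_derivI[OF assms(1) open_ball])
  then have "((\<lambda>z. F (of_real r * z)) has_field_derivative deriv F (of_real r * z) * of_real r) (at z)"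
    by (rule DERIV_chain2) (auto intro!: derivative_eq_intros)
  then have "((\<lambda>z. F (of_real r * z) / of_real r) has_field_derivative
      deriv F (of_real r * z) * of_real r / of_real r) (at z)"
    by (rule DERIV_cdivide)
  then show ?thesis
    using assms(2) by (intro DERIV_imp_deriv) simp
qed

lemma starlike_quot_dilate:
  fixes F :: "complex \<Rightarrow> complex" and r :: real
  assumes "F holomorphic_on unit_disk" "0 < r" "norm (of_real r * z) < 1"
  shows "starlike_quot (\<lambda>z. F (of_real r * z) / of_real r) z = starlike_quot F (of_real r * z)"
  using assms(2) by (simp add: starlike_quot_def deriv_dilate[OF assms])

text \<open>Because \<open>\<phi>_R\<close> is univalent, subordination reduces to an inclusion of
  values: the Schwarz function is the inverse of \<open>\<phi>_R\<close> after the quotient, and it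
  fixes 0 since \<open>\<phi>_R 0 = 1\<close>.\<close>

lemma dilate_in_S_R:
  fixes F :: "complex \<Rightarrow> complex" and r :: real
  assumes F: "F \<in> class_A" "\<And>z. z \<in> unit_disk - {0} \<Longrightarrow> F z \<noteq> 0"
    and r: "0 < r" "r < 1"
    and val: "\<And>z. norm z < r \<Longrightarrow> starlike_quot F z \<in> \<phi>_R ` unit_disk"
  shows "(\<lambda>z. F (of_real r * z) / of_real r) \<in> S_R"
proof -
  define G where "G = (\<lambda>z. F (of_real r * z) / of_real r)"
  have F': "F holomorphic_on unit_disk" "F 0 = 0" "deriv F 0 = 1"
    using F(1) by (auto simp: class_A_def)
  have nr: "norm (of_real r * z) < r" if "norm z < 1" for z :: complex
    using that r(1) by (simp add: norm_mult)
  have nr1: "norm (of_real r * z) < 1" if "norm z < 1" for z :: complex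
    using nr[OF that] r(2) by linarith
  have "(F \<circ> (\<lambda>z. of_real r * z)) holomorphic_on unit_disk"
    by (rule holomorphic_on_compose_gen[OF _ F'(1)])
       (use nr1 in \<open>auto intro!: holomorphic_intros\<close>)
  then have "G holomorphic_on unit_disk"
    using r(1) unfolding G_def o_def by (intro holomorphic_intros) auto
  moreover have "deriv G 0 = 1"
    using deriv_dilate[OF F'(1) r(1), of 0] F'(3) by (simp add: G_def)
  ultimately have GA: "G \<in> class_A"
    using F'(2) by (simp add: class_A_def G_def)
  have G0: "G z \<noteq> 0" if "z \<in> unit_disk - {0}" for z
    using F(2)[of "of_real r * z"] nr1[of z] that r(1) by (simp add: G_def)
  have hol: "starlike_quot G holomorphic_on unit_disk"
    by (rule starlike_quot_holomorphic[OF GA G0])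
  have G_val: "starlike_quot G z \<in> \<phi>_R ` unit_disk" if "z \<in> unit_disk" for z
    using val[OF nr] starlike_quot_dilate[OF F'(1) r(1) nr1] that by (simp add: G_def)
  have \<phi>: "\<phi>_R holomorphic_on unit_disk"
    using holomorphic_on_subset[OF \<phi>_R_holomorphic] by auto
  obtain g where g: "g holomorphic_on (\<phi>_R ` unit_disk)" "\<And>z. z \<in> unit_disk \<Longrightarrow> g (\<phi>_R z) = z"
    using holomorphic_has_inverse[OF \<phi> open_ball \<phi>_R_inj] by metis
  have "subordinate (starlike_quot G) \<phi>_R"
    unfolding subordinate_def
  proof (intro conjI exI ballI)
    show "(g \<circ> starlike_quot G) holomorphic_on unit_disk"
      using G_val by (intro holomorphic_on_compose_gen[OF hol g(1)]) auto
    show "g \<circ> starlike_quot G \<in> unit_disk \<rightarrow> unit_disk"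
    proof
      fix z :: complex assume "z \<in> unit_disk"
      then obtain x where "x \<in> unit_disk" "starlike_quot G z = \<phi>_R x"
        using G_val by blast
      then show "(g \<circ> starlike_quot G) z \<in> unit_disk"
        using g(2) by simp
    qed
    have "\<phi>_R 0 = 1"
      by (simp add: \<phi>_R_def)
    then show "(g \<circ> starlike_quot G) 0 = 0"
      using g(2)[of 0] by (simp add: starlike_quot_def)
    fix z :: complex assume "z \<in> unit_disk"
    then obtain x where "x \<in> unit_disk" "starlike_quot G z = \<phi>_R x"
      using G_val by blast
    then show "starlike_quot G z = \<phi>_R ((g \<circ> starlike_quot G) z)"
      using g(2) by simp
  qed (fact hol \<phi>)+
  then show ?thesis
    using GA G0 by (simp add: S_R_def G_def)
qed

text \<open>The converse direction, used to bound admissible radii from above. For \<open>r\<close>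
  strictly between \<open>norm z\<close> and \<open>\<rho>\<close>, the value at \<open>z\<close> is
  that of the dilate at \<open>z / r\<close>.\<close>

lemma admissible_radii_S_R_imp_value:
  assumes "\<rho> \<in> admissible_radii S_R \<F>" "F \<in> \<F>" "F \<in> class_A" "norm z < \<rho>"
  shows "starlike_quot F z \<in> \<phi>_R ` unit_disk"
proof -
  obtain r where r: "norm z < r" "r < \<rho>"
    using dense assms(4) by blast
  have r0: "0 < r" "r < 1"
    using r assms(1) norm_ge_zero[of z] by (auto simp: admissible_radii_def simp del: norm_ge_zero)
  then have "subordinate (starlike_quot (\<lambda>z. F (of_real r * z) / of_real r)) \<phi>_R"
    using assms(1,2) r(2) by (auto simp: admissible_radii_def S_R_def)
  moreover have "z / of_real r \<in> unit_disk"
    using r(1) r0 by (simp add: norm_divide)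
  ultimately have "starlike_quot (\<lambda>z. F (of_real r * z) / of_real r) (z / of_real r) \<in> \<phi>_R ` unit_disk"
    unfolding subordinate_def by (metis PiE image_eqI)
  moreover have "F holomorphic_on unit_disk" "norm (of_real r * (z / of_real r)) < 1"
    using assms(3) r r0 by (auto simp: class_A_def)
  ultimately show ?thesis
    using starlike_quot_dilate[of F r "z / of_real r"] r0 by simp
qed

section \<open>Lower bound, extremal function and the radius\<close>

lemma family_F_value:
  assumes "F \<in> family_F \<alpha> \<beta> n" "\<alpha> < 1" "0 < \<beta>" "1 \<le> n"
    and "norm z < \<sigma>0 \<alpha> \<beta>" "norm z < \<sigma>0_tilde \<alpha> \<beta>"
  shows "starlike_quot F z \<in> \<phi>_R ` unit_disk"
proof -
  define x where "x = norm z"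
  have x: "0 \<le> x" "x < 1"
    using assms(5) \<sigma>0_root(2)[OF assms(2,3)] by (auto simp: x_def)
  have x2: "0 < 1 - x\<^sup>2"
    using x by (simp add: abs_square_less_1)
  \<comment> \<open>\<open>a\<close> and \<open>\<rho>\<close> are centre and radius of the disk in
    \<open>family_F_starlike_quot_disk\<close>; positivity of the two quadratics at \<open>x\<close>
    keeps its real diameter strictly between the boundary points.\<close>
  define a where "a = (1 + (1 - 2 * \<alpha> - \<beta>) * x\<^sup>2) / (1 - x\<^sup>2)"
  define \<rho> where "\<rho> = (2 - 2 * \<alpha> + \<beta>) * x / (1 - x\<^sup>2)"
  have "sgn ((2 * sqrt 2 - 1 - 2 * \<alpha> - \<beta>) * x\<^sup>2 - (2 - 2 * \<alpha> + \<beta>) * x + (3 - 2 * sqrt 2)) = 1"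
    using \<sigma>0_root(5)[OF assms(2,3), of x] x assms(5) by (simp add: x_def)
  then have "0 < ((2 * sqrt 2 - 1 - 2 * \<alpha> - \<beta>) * x\<^sup>2 - (2 - 2 * \<alpha> + \<beta>) * x + (3 - 2 * sqrt 2)) / (1 - x\<^sup>2)"
    using x2 by (simp add: sgn_1_pos)
  also have "\<dots> = a - \<rho> - (2 * sqrt 2 - 2)"
    using x2 unfolding a_def \<rho>_def by (simp add: divide_simps) (simp add: algebra_simps)
  finally have 1: "2 * sqrt 2 - 2 < a - \<rho>" by simp
  have "sgn ((2 * \<alpha> - 3 + \<beta>) * x\<^sup>2 - (2 - 2 * \<alpha> + \<beta>) * x + 1) = 1"
    using \<sigma>0_tilde_root(4)[OF assms(2,3), of x] x assms(6) by (simp add: x_def)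
  then have "0 < ((2 * \<alpha> - 3 + \<beta>) * x\<^sup>2 - (2 - 2 * \<alpha> + \<beta>) * x + 1) / (1 - x\<^sup>2)"
    using x2 by (simp add: sgn_1_pos)
  also have "\<dots> = 2 - (a + \<rho>)"
    using x2 unfolding a_def \<rho>_def by (simp add: divide_simps) (simp add: algebra_simps)
  finally have 2: "a + \<rho> < 2" by simp
  have "0 \<le> \<rho>"
    using x x2 assms(2,3) by (simp add: \<rho>_def)
  moreover have "starlike_quot F z \<in> cball (of_real a) \<rho>"
    using family_F_starlike_quot_disk[OF assms(1-4), of z] x(2)
    by (simp only: x_def[symmetric] a_def[symmetric] \<rho>_def[symmetric] mem_cball dist_norm
        norm_minus_commute)
  ultimately show ?thesis
    using cball_subset_\<phi>_R_image[OF 1 2] by blast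
qed

text \<open>The generalized Koebe function \<open>z * (1 - z) powr (2 * \<alpha> - 2)\<close>; the
  principal logarithm is analytic here because \<open>Re (1 - z) > 0\<close>. Starlikeness of order
  \<open>\<alpha>\<close> comes from \<open>Re (z / (1 - z)) > - 1 / 2\<close>.\<close>

lemma koebe_in_ST:
  fixes \<alpha> :: real
  defines "f \<equiv> \<lambda>z. z * exp (- of_real (2 - 2 * \<alpha>) * Ln (1 - z))"
  assumes "\<alpha> < 1"
  shows "f \<in> ST \<alpha>"
    and "\<And>z. norm z < 1 \<Longrightarrow> starlike_quot f z = 1 + of_real (2 - 2 * \<alpha>) * (z / (1 - z))"
proof -
  define c where "c = 2 - 2 * \<alpha>"
  have Re: "0 < Re (1 - z)" if "norm z < 1" for z
    using that abs_Re_le_cmod[of z] by auto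
  have nonneg: "1 - z \<notin> \<real>\<^sub>\<le>\<^sub>0" "1 - z \<noteq> 0" if "norm z < 1" for z :: complex
    using Re[OF that] by (auto simp: complex_nonpos_Reals_iff complex_eq_iff)
  have df: "(f has_field_derivative exp (- of_real c * Ln (1 - z))
      + z * (exp (- of_real c * Ln (1 - z)) * (of_real c / (1 - z)))) (at z)" if "norm z < 1" for z
    unfolding f_def c_def[symmetric] using nonneg[OF that]
    by (auto intro!: derivative_eq_intros simp: field_simps)
  have "f holomorphic_on unit_disk"
    unfolding f_def using nonneg by (intro holomorphic_intros) auto
  moreover have "deriv f 0 = 1"
    using DERIV_imp_deriv[OF df[of 0]] by simp
  ultimately have A: "f \<in> class_A"
    by (simp add: class_A_def f_def)
  show quot: "starlike_quot f z = 1 + of_real (2 - 2 * \<alpha>) * (z / (1 - z))" if "norm z < 1" for z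
    using DERIV_imp_deriv[OF df[OF that]] nonneg[OF that]
    by (simp add: starlike_quot_def f_def c_def[symmetric] divide_simps) (simp add: algebra_simps)
  have "\<alpha> < Re (starlike_quot f z)" if "norm z < 1" for z
  proof -
    have "(norm z)\<^sup>2 < 1"
      using that by (simp add: abs_square_less_1)
    then have "(norm (1 - z))\<^sup>2 < 2 * Re (1 - z)"
      unfolding cmod_power2 by (simp add: power2_eq_square algebra_simps)
    then have "1 / 2 < Re (1 / (1 - z))"
    proof -
      have "Re (1 / (1 - z)) = Re (1 - z) / (norm (1 - z))\<^sup>2"
        by (simp add: Re_divide cmod_power2)
      moreover have "0 < (norm (1 - z))\<^sup>2"
        using nonneg(2)[OF that] by simp
      ultimately show ?thesis
        using \<open>(norm (1 - z))\<^sup>2 < 2 * Re (1 - z)\<close> by (simp only: less_divide_eq if_True)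
    qed
    moreover have "z / (1 - z) = 1 / (1 - z) - 1"
      using nonneg[OF that] by (simp add: field_simps)
    ultimately have "- (1 / 2) < Re (z / (1 - z))"
      by simp
    then have "c * - (1 / 2) < c * Re (z / (1 - z))"
      using assms(2) by (intro mult_strict_left_mono) (auto simp: c_def)
    moreover have "Re (of_real c * w) = c * Re w" for w
      by simp
    moreover have "c * - (1 / 2) = \<alpha> - 1"
      by (simp add: c_def field_simps)
    ultimately have "\<alpha> - 1 < Re (of_real c * (z / (1 - z)))"
      by (simp only:)
    then show ?thesis
      unfolding quot[OF that] c_def[symmetric] by simp
  qed
  then show "f \<in> ST \<alpha>"
    using A by (auto simp: ST_def f_def)
qed

text \<open>All \<open>n\<close> zeros of \<open>Q\<close> are placed at -1, so the branch is
  \<open>(1 + z) powr \<beta>\<close>. For \<open>0 \<le> r\<close> the values at \<open>r\<close>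
  and \<open>- r\<close> are then the right and left ends of the real diameter of the disk in
  \<open>family_F_starlike_quot_disk\<close>.\<close>

lemma family_F_extremal:
  assumes "\<alpha> < 1" "1 \<le> n"
  obtains F where "F \<in> family_F \<alpha> \<beta> n" "F \<in> class_A"
    "\<And>x. \<bar>x\<bar> < 1 \<Longrightarrow> starlike_quot F (of_real x) =
       of_real ((1 + (2 - 2 * \<alpha> + \<beta>) * x + (1 - 2 * \<alpha> - \<beta>) * x\<^sup>2) / (1 - x\<^sup>2))"
proof -
  define f where "f = (\<lambda>z. z * exp (- of_real (2 - 2 * \<alpha>) * Ln (1 - z)))"
  define Q :: "complex poly" where "Q = [:1, 1:] ^ n"
  define h where "h = (\<lambda>z. exp (of_real (\<beta> / real n) * (of_nat n * Ln (1 + z))))"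
  have f: "f \<in> ST \<alpha>" "\<And>z. norm z < 1 \<Longrightarrow> starlike_quot f z = 1 + of_real (2 - 2 * \<alpha>) * (z / (1 - z))"
    using koebe_in_ST[OF assms(1)] by (simp_all add: f_def)
  have nz: "1 + z \<notin> \<real>\<^sub>\<le>\<^sub>0" "1 + z \<noteq> 0" if "norm z < 1" for z :: complex
    using that abs_Re_le_cmod[of z] by (auto simp: complex_nonpos_Reals_iff complex_eq_iff)
  have h: "is_power_branch (poly Q) (\<beta> / real n) h"
    unfolding is_power_branch_def
  proof (intro exI[of _ "\<lambda>z. of_nat n * Ln (1 + z)"] conjI ballI)
    show "(\<lambda>z. of_nat n * Ln (1 + z)) holomorphic_on unit_disk"
      using nz by (intro holomorphic_intros) auto
    show "exp (of_nat n * Ln (1 + z)) = poly Q z" if "z \<in> unit_disk" for z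
      using nz[of z] that by (simp add: exp_of_nat_mult Q_def)
  qed (simp_all add: h_def)
  define F where "F = (\<lambda>z. f z * h z)"
  have f': "f \<in> class_A" "\<And>z. z \<in> unit_disk - {0} \<Longrightarrow> f z \<noteq> 0"
    using f(1) by (auto simp: ST_def)
  note * = starlike_quot_mult_power_branch[OF f' h, of F]
  show thesis
  proof (rule that[of F])
    have "degree Q = n" "poly Q 0 = 1"
      by (simp_all add: Q_def degree_power_eq)
    moreover have "z \<notin> unit_disk" if "poly Q z = 0" for z
      using that nz(2)[of z] by (auto simp: Q_def)
    ultimately show "F \<in> family_F \<alpha> \<beta> n"
      unfolding family_F_def F_def using f(1) h by blast
    show "F \<in> class_A"
      using * by (simp add: F_def)
    fix x :: real assume x: "\<bar>x\<bar> < 1"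
    have x1: "1 + x \<noteq> 0" "1 - x \<noteq> 0"
      using x by auto
    have nx: "norm (complex_of_real x) < 1"
      using x by simp
    obtain m where m: "n = Suc m"
      using assms(2) by (cases n) auto
    have "poly (pderiv Q) z / poly Q z = of_nat n / (1 + z)" if "norm z < 1" for z
    proof -
      have "poly Q z = (1 + z) * (1 + z) ^ m" "poly (pderiv Q) z = of_nat n * (1 + z) ^ m"
        unfolding Q_def m pderiv_power_Suc poly_power poly_mult poly_smult
        by (simp_all add: pderiv_pCons)
      then show ?thesis
        using nz(2)[OF that] by simp
    qed
    then have "starlike_quot F (of_real x) = 1 + of_real (2 - 2 * \<alpha>) * (of_real x / (1 - of_real x))
        + of_real (\<beta> / real n) * (of_real x * (of_nat n / (1 + of_real x)))"
      using *(3)[of "of_real x"] f(2)[OF nx] nx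
      by (simp only: F_def mem_ball dist_0_norm times_divide_eq_right[symmetric])
    also have "\<dots> = of_real (1 + (2 - 2 * \<alpha>) * (x / (1 - x)) + \<beta> / real n * (x * (real n / (1 + x))))"
      by simp
    also have "1 + (2 - 2 * \<alpha>) * (x / (1 - x)) + \<beta> / real n * (x * (real n / (1 + x))) =
        1 + (2 - 2 * \<alpha>) * x / (1 - x) + \<beta> * x / (1 + x)"
      using assms(2) by simp
    also have "\<dots> = (1 + (2 - 2 * \<alpha> + \<beta>) * x + (1 - 2 * \<alpha> - \<beta>) * x\<^sup>2) / ((1 - x) * (1 + x))"
      using x1 by (simp add: field_simps power2_eq_square)
    also have "(1 - x) * (1 + x) = 1 - x\<^sup>2"
      by (simp add: power2_eq_square algebra_simps)
    finally show "starlike_quot F (of_real x) =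
        of_real ((1 + (2 - 2 * \<alpha> + \<beta>) * x + (1 - 2 * \<alpha> - \<beta>) * x\<^sup>2) / (1 - x\<^sup>2))" .
  qed
qed

theorem theorem5p2:
  fixes \<alpha> \<beta> :: real and n :: nat
  assumes "0 \<le> \<alpha>" "\<alpha> < 1" "0 < \<beta>" "1 \<le> n"
    and "\<not> exceptional \<alpha> \<beta>"
  shows "is_class_radius S_R (family_F \<alpha> \<beta> n)
           (if 2 * \<alpha> + \<beta> - 2 \<ge> 0 then \<sigma>0 \<alpha> \<beta>
            else if X \<alpha> \<beta> \<le> 0 then \<sigma>0 \<alpha> \<beta>
            else \<sigma>0_tilde \<alpha> \<beta>)"
proof -
  define s t where "s = \<sigma>0 \<alpha> \<beta>" and "t = \<sigma>0_tilde \<alpha> \<beta>"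
  note s = \<sigma>0_root(1-3)[OF assms(2,3), folded s_def]
    and t = \<sigma>0_tilde_root(1-3)[OF assms(2,3), folded t_def]
  have "(\<lambda>z. F (of_real r * z) / of_real r) \<in> S_R"
    if F: "F \<in> family_F \<alpha> \<beta> n" and r: "0 < r" "r < min s t" for F r
  proof (rule dilate_in_S_R[OF family_F_properties(1,2)[OF F] r(1)])
    show "r < 1"
      using r(2) s(2) by simp
    show "starlike_quot F z \<in> \<phi>_R ` unit_disk" if "norm z < r" for z
      using that r(2) by (intro family_F_value[OF F assms(2-4)]) (auto simp: s_def t_def)
  qed
  then have "min s t \<in> admissible_radii S_R (family_F \<alpha> \<beta> n)"
    using s t by (auto simp: admissible_radii_def)
  moreover have "\<rho> \<le> min s t" if \<rho>: "\<rho> \<in> admissible_radii S_R (family_F \<alpha> \<beta> n)" for \<rho>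
  proof -
    obtain F where F: "F \<in> family_F \<alpha> \<beta> n" "F \<in> class_A"
      and val: "\<And>x. \<bar>x\<bar> < 1 \<Longrightarrow> starlike_quot F (of_real x) =
        of_real ((1 + (2 - 2 * \<alpha> + \<beta>) * x + (1 - 2 * \<alpha> - \<beta>) * x\<^sup>2) / (1 - x\<^sup>2))"
      using family_F_extremal[OF assms(2,4)] by blast
    note in_image = admissible_radii_S_R_imp_value[OF \<rho> F]
    have "1 - s\<^sup>2 \<noteq> 0" "1 - t\<^sup>2 \<noteq> 0"
      using s t by (auto simp: abs_square_eq_1)
    \<comment> \<open>By the quadratic for \<open>s\<close>, the value at \<open>- s\<close> is
      \<open>\<phi>_R (- 1)\<close>; an admissible radius beyond \<open>s\<close> would put this
      omitted value into the image.\<close>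
    have "starlike_quot F (of_real (- s)) = of_real (2 * sqrt 2 - 2)"
    proof -
      have "(1 + (2 - 2 * \<alpha> + \<beta>) * (- s) + (1 - 2 * \<alpha> - \<beta>) * (- s)\<^sup>2) / (1 - (- s)\<^sup>2) = 2 * sqrt 2 - 2"
        using s(3) \<open>1 - s\<^sup>2 \<noteq> 0\<close> by (simp add: divide_simps) (simp add: algebra_simps)
      then show ?thesis
        using val[of "- s"] s by simp
    qed
    then have "\<not> s < \<rho>"
      using in_image[of "of_real (- s)"] \<phi>_R_omits(2) s by auto
    \<comment> \<open>In the same way the omitted value \<open>\<phi>_R 1\<close> is attained at
      \<open>t\<close>.\<close>
    moreover have "starlike_quot F (of_real t) = 2"
    proof -
      have "(1 + (2 - 2 * \<alpha> + \<beta>) * t + (1 - 2 * \<alpha> - \<beta>) * t\<^sup>2) / (1 - t\<^sup>2) = 2"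
        using t(3) \<open>1 - t\<^sup>2 \<noteq> 0\<close> by (simp add: divide_simps) (simp add: algebra_simps)
      then show ?thesis
        using val[of t] t by simp
    qed
    then have "\<not> t < \<rho>"
      using in_image[of "of_real t"] \<phi>_R_omits(1) t by auto
    ultimately show ?thesis by simp
  qed
  ultimately show ?thesis
    unfolding is_class_radius_def radius_eq_min[OF assms(2,3,5)] s_def t_def by blast
qed

end
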